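(* Let $X$ be a Banach space which fails the approximation property, and let $Z=Z_X$ be the Willis space associated to $X$ (as described in the context). Then there is a linear isomorphic embedding $\psi: c_0 \to \mathcal K(Z)/\mathcal A(Z)$, i.e. $\mathcal K(Z)/\mathcal A(Z)$ contains a closed subspace linearly isomorphic to $c_0$.
   Context: For Banach spaces $X,Y$, $\mathcal K(X,Y)$ denotes the compact operators $X\to Y$ with the operator norm, $\mathcal F(X,Y)$ the bounded finite rank operators, $\mathcal A(X,Y)=\overline{\mathcal F(X,Y)}$ the approximable operators; $\mathcal K(X)=\mathcal K(X,X)$, $\mathcal A(X)=\mathcal A(X,X)$, and $\mathcal K(X)/\mathcal A(X)$ is the quotient Banach algebra with norm $\|T+\mathcal A(X)\|=\inf_{S\in\mathcal A(X)}\|T-S\|$. $X$ has the approximation property (A.P.) if for every compact $K\subset X$ and $\varepsilon>0$ there is $T\in\mathcal F(X)$ with $\sup_{x\in K}\|x-Tx\|\le\varepsilon$. Willis space: Since $X$ fails the A.P., one may fix a sequence $(x_n)$ in $X$ with $0<\|x_n\|\le 1$ and $\|x_n\|\to 0$, and a constant $c>0$, such that $K=\overline{conv}\{\pm x_n:n\in\mathbb N\}$ satisfies $\sup_{x\in K}\|x-Vx\|\ge c$ for every $V\in\mathcal F(X)$. For $0<t<1$ let $U_t=\overline{conv}\{\pm x_n/\|x_n\|^t: n\in\mathbb N\}\subset X$, let $Y_t$ be the linear span of $U_t$ in $X$, normed by the Minkowski functional $|x|_t=\inf\{\lambda>0: x\in\lambda U_t\}$ (then $(Y_t,|\cdot|_t)$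 is a Banach space, $Y_s\subset Y_t$ and $\|x\|\le|x|_t\le|x|_s$ for $x\in Y_s$, $0<s<t<1$). Let $\mathcal Z$ be the linear span of the functions $y\chi_{(s,t)}$ on $(0,1)$ with $0<s<t<1$, $y\in Y_s$, normed by $\|f\|=\int_0^1|f(r)|_r\,dr$, i.e. $\|f\|=\sum_{k=1}^n\int_{u_k}^{v_k}|y_k|_r\,dr$ for $f=\sum_{k=1}^n y_k\chi_{(u_k,v_k)}$ with $0<u_1<v_1\le u_2<\dots\le u_n<v_n<1$, $y_k\in Y_{u_k}$. The Willis space $Z=Z_X$ is the completion of $(\mathcal Z,\|\cdot\|)$. *)

theory Defs
  imports "HOL-Analysis.Analysis"
begin

definition finite_rank :: "('a::real_normed_vector \<Rightarrow>\<^sub>L 'b::real_normed_vector) \<Rightarrow> bool" where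
  "finite_rank T \<longleftrightarrow> (\<exists>B. finite B \<and> range (blinfun_apply T) \<subseteq> span B)"

definition compact_op :: "('a::real_normed_vector \<Rightarrow>\<^sub>L 'b::real_normed_vector) \<Rightarrow> bool" where
  "compact_op T \<longleftrightarrow> compact (closure (blinfun_apply T ` ball 0 1))"

definition approximable_ops :: "('a::real_normed_vector \<Rightarrow>\<^sub>L 'b::real_normed_vector) set" where
  "approximable_ops = closure {T. finite_rank T}"

definition quot_norm :: "('a::real_normed_vector \<Rightarrow>\<^sub>L 'a) \<Rightarrow> real" where
  "quot_norm T = infdist T approximable_ops"

definition has_AP :: "'a::real_normed_vector itself \<Rightarrow> bool" where
  "has_AP _ \<longleftrightarrow> (\<forall>K::'a set. compact K \<longrightarrow> (\<forall>\<epsilon>>0. \<exists>T::'a \<Rightarrow>\<^sub>L 'a. finite_rank T \<and>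
      (\<forall>x\<in>K. norm (x - T x) \<le> \<epsilon>)))"

definition willis_U :: "(nat \<Rightarrow> 'a::real_normed_vector) \<Rightarrow> real \<Rightarrow> 'a set" where
  "willis_U x t = closure (convex hull
     (\<Union>n. {(1 / (norm (x n) powr t)) *\<^sub>R x n, - ((1 / (norm (x n) powr t)) *\<^sub>R x n)}))"

definition willis_Y :: "(nat \<Rightarrow> 'a::real_normed_vector) \<Rightarrow> real \<Rightarrow> 'a set" where
  "willis_Y x t = span (willis_U x t)"

definition willis_tnorm :: "(nat \<Rightarrow> 'a::real_normed_vector) \<Rightarrow> real \<Rightarrow> 'a \<Rightarrow> real" where
  "willis_tnorm x t y = Inf {l. l > 0 \<and> y \<in> (\<lambda>u. l *\<^sub>R u) ` willis_U x t}"

text \<open>The space calZ: linear span of the step functions y chi_(s,t), 0<s<t<1, y in Y_s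
  (written out as the set of finite sums of such functions).\<close>
definition willis_steps :: "(nat \<Rightarrow> 'a::real_normed_vector) \<Rightarrow> (real \<Rightarrow> 'a) set" where
  "willis_steps x = {f. \<exists>(n::nat) u v y.
      (\<forall>k<n. 0 < u k \<and> u k < v k \<and> v k < 1 \<and> y k \<in> willis_Y x (u k)) \<and>
      f = (\<lambda>r. \<Sum>k<n. indicator {u k<..<v k} r *\<^sub>R y k)}"

definition willis_norm :: "(nat \<Rightarrow> 'a::real_normed_vector) \<Rightarrow> (real \<Rightarrow> 'a) \<Rightarrow> real" where
  "willis_norm x f = integral {0..1} (\<lambda>r. willis_tnorm x r (f r))"

definition c0 :: "(nat \<Rightarrow> real) set" where
  "c0 = {a. a \<longlonglongrightarrow> 0}"

definition c0_norm :: "(nat \<Rightarrow> real) \<Rightarrow> real" where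
  "c0_norm a = (SUP n. \<bar>a n\<bar>)"

end

theory Submission
  imports Defs
begin

text \<open>
  For a bounded sequence \<open>a\<close> let \<open>g\<close> be the function on \<open>(0, 1/2)\<close> taking the value \<open>a n\<close>
  on \<open>(1/(n+3), 1/(n+2))\<close>, and let \<open>\<psi> a\<close> send \<open>f\<close> to the function that is constantly
  \<open>5 \<integral> g f\<close> on \<open>(3/5, 4/5)\<close>. This factors through the compact inclusion of \<open>Y\<close> at \<open>1/2\<close>
  into \<open>Y\<close> at \<open>3/5\<close>, so it is compact, and its norm is at most the supremum of \<open>|a n|\<close>.

  For the lower bound put \<open>s = 1/(n+3)\<close>. Composing \<open>\<psi> a\<close> with the normalised bump
  \<open>y \<mapsto> y \<chi> / |(s, 1/(n+2))|\<close> on the right and with integration over \<open>(3/5, 4/5)\<close> on the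
  left gives \<open>a n\<close> times the inclusion of \<open>Y\<close> at \<open>s\<close> into \<open>X\<close>. A finite rank operator near
  \<open>\<psi> a\<close> thus yields a finite rank map near that inclusion. By Hahn-Banach its coordinate
  functionals can be replaced by functionals on \<open>X\<close> with small error on \<open>K\<close>, because \<open>K\<close> is
  compact in \<open>Y\<close> at \<open>s\<close>; the choice of \<open>K\<close> then bounds the distance below by \<open>c |a n|\<close>.
\<close>

section \<open>Hahn-Banach and extension of operators\<close>

text \<open>Positive homogeneity is demanded as an inequality because pointwise infima inherit it
  directly; applying it to \<open>inverse t\<close> yields the reverse inequality.\<close>

definition sublinear :: "('a::real_vector \<Rightarrow> real) \<Rightarrow> bool" where
  "sublinear p \<longleftrightarrow> (\<forall>x y. p (x + y) \<le> p x + p y) \<and> (\<forall>t>0. \<forall>x. p (t *\<^sub>R x) \<le> t * p x)"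

lemma sublinear_add: "sublinear p \<Longrightarrow> p (x + y) \<le> p x + p y"
  and sublinear_scaleR_le: "sublinear p \<Longrightarrow> t > 0 \<Longrightarrow> p (t *\<^sub>R x) \<le> t * p x"
  by (auto simp: sublinear_def)

lemma sublinear_0: assumes "sublinear p" shows "p 0 = 0"
proof -
  have "p 0 \<le> p 0 + p 0" using sublinear_add[OF assms, of 0 0] by simp
  moreover have "p 0 \<le> (1/2) * p 0" using sublinear_scaleR_le[OF assms, of "1/2" 0] by simp
  ultimately show ?thesis by simp
qed

lemma sublinear_scaleR: assumes "sublinear p" "t \<ge> 0" shows "p (t *\<^sub>R x) = t * p x"
proof (cases "t = 0")
  case True then show ?thesis using sublinear_0[OF assms(1)] by simp
next
  case False
  then have t: "t > 0" using assms by simp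
  have "p (inverse t *\<^sub>R (t *\<^sub>R x)) \<le> inverse t * p (t *\<^sub>R x)"
    using sublinear_scaleR_le[OF assms(1)] t by (metis positive_imp_inverse_positive)
  then have "t * p x \<le> p (t *\<^sub>R x)" using t by (simp add: field_simps)
  then show ?thesis using sublinear_scaleR_le[OF assms(1) t, of x] by simp
qed

lemma sublinear_minus: assumes "sublinear p" shows "- p (- x) \<le> p x"
  using sublinear_add[OF assms, of x "-x"] sublinear_0[OF assms] by simp

text \<open>Minimality is tested against \<open>y \<mapsto> inf\<^sub>t (p (y + t v) - t p v)\<close>, which forces additivity.\<close>

lemma minimal_sublinear_imp_linear:
  assumes p: "sublinear p" and min: "\<And>q. sublinear q \<Longrightarrow> q \<le> p \<Longrightarrow> q = p"
  shows "linear p"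
proof -
  have add: "p (x + v) = p x + p v" for x v
  proof -
    define q where "q = (\<lambda>y. INF t\<in>{0..}. p (y + t *\<^sub>R v) - t * p v)"
    \<comment> \<open>Subadditivity at \<open>t *\<^sub>R v = (y + t *\<^sub>R v) + (- y)\<close>
      bounds the family below independently of \<open>t\<close>, so the infimum is finite.\<close>
    have low: "- p (- y) \<le> p (y + t *\<^sub>R v) - t * p v" if "t \<ge> 0" for t y
      using sublinear_add[OF p, of "y + t *\<^sub>R v" "- y"] sublinear_scaleR[OF p that, of v] by simp
    have bdd: "bdd_below ((\<lambda>t. p (y + t *\<^sub>R v) - t * p v) ` {0..})" for y
      using low[of _ y] by (intro bdd_belowI2) auto
    have qle: "q y \<le> p (y + t *\<^sub>R v) - t * p v" if "t \<ge> 0" for t y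
      unfolding q_def by (rule cINF_lower[OF bdd]) (use that in auto)
    have qge: "k \<le> q y" if "\<And>t. t \<ge> 0 \<Longrightarrow> k \<le> p (y + t *\<^sub>R v) - t * p v" for k y
      unfolding q_def by (rule cINF_greatest) (use that in auto)
    have "sublinear q"
      unfolding sublinear_def
    proof (intro conjI allI impI)
      fix y z
      have *: "q (y + z) \<le> (p (y + s *\<^sub>R v) - s * p v) + (p (z + t *\<^sub>R v) - t * p v)"
        if "s \<ge> 0" "t \<ge> 0" for s t
        using qle[of "s + t" "y + z"] sublinear_add[OF p, of "y + s *\<^sub>R v" "z + t *\<^sub>R v"] that
        by (simp add: algebra_simps)
      have "q (y + z) - (p (z + t *\<^sub>R v) - t * p v) \<le> q y" if "t \<ge> 0" for t
        by (rule qge) (use *[OF _ that] in \<open>simp add: algebra_simps\<close>)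
      then have "q (y + z) - q y \<le> q z"
        by (intro qge) (simp add: algebra_simps)
      then show "q (y + z) \<le> q y + q z" by simp
    next
      fix l :: real and y assume l: "l > 0"
      have "q (l *\<^sub>R y) / l \<le> q y"
      proof (rule qge)
        fix t :: real assume t: "t \<ge> 0"
        have "q (l *\<^sub>R y) \<le> p (l *\<^sub>R (y + t *\<^sub>R v)) - (l * t) * p v"
          using qle[of "l * t" "l *\<^sub>R y"] l t by (simp add: algebra_simps)
        also have "\<dots> \<le> l * (p (y + t *\<^sub>R v) - t * p v)"
          using sublinear_scaleR_le[OF p l, of "y + t *\<^sub>R v"] by (simp add: algebra_simps)
        finally show "q (l *\<^sub>R y) / l \<le> p (y + t *\<^sub>R v) - t * p v" using l by (simp add: field_simps)
      qed
      then show "q (l *\<^sub>R y) \<le> l * q y" using l by (simp add: field_simps)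
    qed
    moreover have "q \<le> p" using qle[of 0] by (simp add: le_fun_def)
    ultimately have "q = p" by (rule min)
    \<comment> \<open>With \<open>q = p\<close>, the member \<open>t = 1\<close> of the infimum is
      the reverse of subadditivity.\<close>
    then have "p x \<le> p (x + v) - p v" using qle[of 1 x] by simp
    then show ?thesis using sublinear_add[OF p, of x v] by simp
  qed
  have neg: "p (- x) = - p x" for x using add[of x "-x"] sublinear_0[OF p] by simp
  show ?thesis
  proof (rule linearI)
    fix r x show "p (r *\<^sub>R x) = r *\<^sub>R p x"
    proof (cases "r \<ge> 0")
      case True then show ?thesis using sublinear_scaleR[OF p] by simp
    next
      case False
      then have "p (- ((- r) *\<^sub>R x)) = - ((- r) * p x)"
        using sublinear_scaleR[OF p, of "- r" x] neg by simp
      then show ?thesis by simp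
    qed
  qed (rule add)
qed

text \<open>Zorn's lemma is applied downwards to the sublinear functionals below \<open>p\<close>:
  pointwise infima of chains stay in the family, and a minimal member is linear.\<close>

lemma sublinear_dominates_linear:
  assumes p: "sublinear p"
  shows "\<exists>h. linear h \<and> (\<forall>x. h x \<le> p x)"
proof -
  define A where "A = {q. sublinear q \<and> q \<le> p}"
  \<comment> \<open>The order is reversed, so the maximal element supplied by Zorn's lemma is a
    minimal functional.\<close>
  let ?P = "\<lambda>f g :: 'a \<Rightarrow> real. g \<le> f"
  have po: "partial_order_on A (relation_of ?P A)"
    by (rule partial_order_on_relation_ofI) auto
  have "\<exists>m\<in>A. \<forall>a\<in>A. ?P m a \<longrightarrow> a = m"
  proof (rule predicate_Zorn[OF po])
    fix C assume C: "C \<in> Chains (relation_of ?P A)"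
    then have CA: "C \<subseteq> A" and chain: "\<And>f g. f \<in> C \<Longrightarrow> g \<in> C \<Longrightarrow> f \<le> g \<or> g \<le> f"
      by (auto simp: Chains_def relation_of_def)
    show "\<exists>u\<in>A. \<forall>a\<in>C. u \<le> a"
    proof (cases "C = {}")
      case True then show ?thesis using p by (auto simp: A_def)
    next
      case False
      define u where "u = (\<lambda>x. INF q\<in>C. q x)"
      \<comment> \<open>All members of the chain share this lower bound, since - p (- x) \<le> - q
        (- x) \<le> q x.\<close>
      have "- p (- x) \<le> q x" if "q \<in> C" for q x
        using sublinear_minus[of q x] that CA by (force simp: A_def le_fun_def dest: spec[of _ "-x"])
      then have bdd: "bdd_below ((\<lambda>q. q x) ` C)" for x by (intro bdd_belowI2)
      have ule: "u x \<le> q x" if "q \<in> C" for q x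
        unfolding u_def by (rule cINF_lower[OF bdd that])
      have uge: "k \<le> u x" if "\<And>q. q \<in> C \<Longrightarrow> k \<le> q x" for k x
        unfolding u_def by (rule cINF_greatest) (use that False in auto)
      have sl: "sublinear q" if "q \<in> C" for q using that CA by (auto simp: A_def)
      have "sublinear u" unfolding sublinear_def
      proof (intro conjI allI impI)
        fix x y
        \<comment> \<open>Here the chain property enters: a common lower member \<open>s\<close> of
          \<open>q\<close> and \<open>r\<close> reduces the two functionals to one.\<close>
        have *: "u (x + y) \<le> q x + r y" if q: "q \<in> C" and r: "r \<in> C" for q r
        proof -
          obtain s where s: "s \<in> C" "s \<le> q" "s \<le> r" using chain[OF q r] q r by blast
          have "u (x + y) \<le> s x + s y"
            using ule[OF s(1), of "x + y"] sublinear_add[OF sl[OF s(1)], of x y] by simp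
          then show ?thesis using le_funD[OF s(2), of x] le_funD[OF s(3), of y] by linarith
        qed
        have "u (x + y) - r y \<le> u x" if "r \<in> C" for r
          by (rule uge) (use *[OF _ that] in \<open>simp add: algebra_simps\<close>)
        then have "u (x + y) - u x \<le> u y" by (intro uge) (simp add: algebra_simps)
        then show "u (x + y) \<le> u x + u y" by simp
      next
        fix t :: real and x assume t: "t > 0"
        have "u (t *\<^sub>R x) / t \<le> u x"
        proof (rule uge)
          fix q assume q: "q \<in> C"
          have "u (t *\<^sub>R x) \<le> t * q x"
            using ule[OF q, of "t *\<^sub>R x"] sublinear_scaleR_le[OF sl[OF q] t, of x] by simp
          then show "u (t *\<^sub>R x) / t \<le> q x" using t by (simp add: field_simps)
        qed
        then show "u (t *\<^sub>R x) \<le> t * u x" using t by (simp add: field_simps)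
      qed
      moreover have "u \<le> p"
        proof -
        obtain q where "q \<in> C" using False by blast
        then show ?thesis using ule[of q] CA by (auto simp: A_def le_fun_def intro: order_trans)
      qed
      ultimately show ?thesis using ule by (intro bexI[of _ u]) (auto simp: A_def le_fun_def)
    qed
  qed
  then obtain m where m: "m \<in> A" "\<And>a. a \<in> A \<Longrightarrow> a \<le> m \<Longrightarrow> a = m" by blast
  have "linear m"
    by (rule minimal_sublinear_imp_linear) (use m in \<open>auto simp: A_def intro: order_trans\<close>)
  then show ?thesis using m(1) by (auto simp: A_def le_fun_def)
qed

text \<open>The infimum \<open>q\<close> of R * norm (x + y) - \<phi> y + \<rho> y over
  \<open>y \<in> S\<close> is sublinear, and \<open>le\<close> keeps it finite. A linear
  \<open>h\<close> below \<open>q\<close> is bounded by the choice \<open>y = 0\<close>, and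
  evaluating at \<open>- y\<close> gives the lower estimate on \<open>S\<close>. Taking \<rho> = 0
  extends a functional; a small \<rho> permits an error, so that \<phi> may be discontinuous for the
  norm of the whole space.\<close>

lemma hahn_banach_sandwich:
  fixes \<phi> \<rho> :: "'a::real_normed_vector \<Rightarrow> real"
  assumes S: "subspace S" and R: "R \<ge> 0"
    and \<phi>_add: "\<And>y z. y \<in> S \<Longrightarrow> z \<in> S \<Longrightarrow> \<phi> (y + z) = \<phi> y + \<phi> z"
    and \<phi>_scale: "\<And>t y. y \<in> S \<Longrightarrow> \<phi> (t *\<^sub>R y) = t * \<phi> y"
    and \<rho>_add: "\<And>y z. y \<in> S \<Longrightarrow> z \<in> S \<Longrightarrow> \<rho> (y + z) \<le> \<rho> y + \<rho> z"
    and \<rho>_scale: "\<And>t y. y \<in> S \<Longrightarrow> t > 0 \<Longrightarrow> \<rho> (t *\<^sub>R y) \<le> t * \<rho> y"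
    and le: "\<And>y. y \<in> S \<Longrightarrow> \<phi> y \<le> R * norm y + \<rho> y"
  shows "\<exists>h :: 'a \<Rightarrow>\<^sub>L real. \<forall>y\<in>S. \<phi> y - \<rho> y \<le> h y"
proof -
  define q where "q = (\<lambda>x. INF y\<in>S. R * norm (x + y) - \<phi> y + \<rho> y)"
  have S0: "0 \<in> S" using S by (rule subspace_0)
  have low: "- (R * norm x) \<le> R * norm (x + y) - \<phi> y + \<rho> y" if "y \<in> S" for x y
  proof -
    have "norm y \<le> norm (x + y) + norm x" using norm_triangle_ineq4[of "x + y" x] by simp
    then have "R * norm y \<le> R * norm (x + y) + R * norm x"
      using R by (metis distrib_left mult_left_mono)
    then show ?thesis using le[OF that] by simp
  qed
  have bdd: "bdd_below ((\<lambda>y. R * norm (x + y) - \<phi> y + \<rho> y) ` S)" for x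
    using low by (intro bdd_belowI2)
  have qle: "q x \<le> R * norm (x + y) - \<phi> y + \<rho> y" if "y \<in> S" for x y
    unfolding q_def by (rule cINF_lower[OF bdd that])
  have qge: "k \<le> q x" if "\<And>y. y \<in> S \<Longrightarrow> k \<le> R * norm (x + y) - \<phi> y + \<rho> y" for k x
    unfolding q_def by (rule cINF_greatest) (use that S0 in auto)
  have "sublinear q" unfolding sublinear_def
  proof (intro conjI allI impI)
    fix x z
    have *: "q (x + z) \<le> (R * norm (x + y) - \<phi> y + \<rho> y) + (R * norm (z + w) - \<phi> w + \<rho> w)"
      if "y \<in> S" "w \<in> S" for y w
    proof -
      have "norm ((x + z) + (y + w)) \<le> norm (x + y) + norm (z + w)"
        using norm_triangle_ineq[of "x + y" "z + w"] by (simp add: algebra_simps)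
      then have "R * norm ((x + z) + (y + w)) \<le> R * norm (x + y) + R * norm (z + w)"
        using R by (metis distrib_left mult_left_mono)
      then show ?thesis
        using qle[OF subspace_add[OF S that], of "x + z"] \<phi>_add[OF that] \<rho>_add[OF that] by linarith
    qed
    have "q (x + z) - (R * norm (z + w) - \<phi> w + \<rho> w) \<le> q x" if "w \<in> S" for w
    proof (rule qge)
      fix y assume "y \<in> S"
      from *[OF this that] show "q (x + z) - (R * norm (z + w) - \<phi> w + \<rho> w) \<le> R * norm (x + y) - \<phi> y + \<rho> y"
        by linarith
    qed
    then have "q (x + z) - q x \<le> q z" by (intro qge) (simp add: algebra_simps)
    then show "q (x + z) \<le> q x + q z" by simp
  next
    fix t :: real and x assume t: "t > 0"
    have "q (t *\<^sub>R x) / t \<le> q x"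
    proof (rule qge)
      fix y assume y: "y \<in> S"
      have "q (t *\<^sub>R x) \<le> R * norm (t *\<^sub>R x + t *\<^sub>R y) - \<phi> (t *\<^sub>R y) + \<rho> (t *\<^sub>R y)"
        by (rule qle) (use y S in \<open>auto intro: subspace_scale\<close>)
      also have "\<dots> \<le> t * (R * norm (x + y) - \<phi> y + \<rho> y)"
        using \<phi>_scale[OF y] \<rho>_scale[OF y t] t
        by (simp add: algebra_simps flip: scaleR_add_right)
      finally show "q (t *\<^sub>R x) / t \<le> R * norm (x + y) - \<phi> y + \<rho> y"
        using t by (simp add: field_simps)
    qed
    then show "q (t *\<^sub>R x) \<le> t * q x" using t by (simp add: field_simps)
  qed
  then obtain h where h: "linear h" "\<And>x. h x \<le> q x" using sublinear_dominates_linear by blast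
  have phi0: "\<phi> 0 = 0" using \<phi>_scale[OF S0, of 0] by simp
  have rho0: "\<rho> 0 \<le> 0" using \<rho>_scale[OF S0, of "1/2"] by simp
  have hR: "h x \<le> R * norm x" for x
    using h(2)[of x] qle[OF S0, of x] phi0 rho0 by simp
  have "\<bar>h x\<bar> \<le> norm x * R" for x
    using hR[of x] hR[of "-x"] linear_neg[OF h(1), of x] by (simp add: mult.commute)
  then have bl: "bounded_linear h"
    using h(1) by (intro bounded_linear_intro[of h R]) (auto simp: linear_add linear_scale)
  have "\<phi> y - \<rho> y \<le> h y" if "y \<in> S" for y
    using h(2)[of "-y"] qle[OF that, of "-y"] linear_neg[OF h(1), of y] by simp
  then show ?thesis by (intro exI[of _ "Blinfun h"]) (simp add: bounded_linear_Blinfun_apply[OF bl])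
qed

text \<open>The coordinate along \<open>v\<close> is extended from the line through \<open>v\<close>
  with \<rho> = 0; testing at both \<open>v\<close> and \<open>- v\<close> turns the inequality into
  an equality.\<close>

lemma exists_blinfun_eq_1:
  fixes v :: "'a::real_normed_vector"
  assumes "v \<noteq> 0"
  shows "\<exists>h :: 'a \<Rightarrow>\<^sub>L real. h v = 1"
proof -
  define \<phi> where "\<phi> = (\<lambda>y. THE t. y = t *\<^sub>R v)"
  have \<phi>: "\<phi> (t *\<^sub>R v) = t" for t unfolding \<phi>_def using assms by auto
  have "\<exists>h :: 'a \<Rightarrow>\<^sub>L real. \<forall>y\<in>span {v}. \<phi> y - 0 \<le> h y"
  proof (rule hahn_banach_sandwich[OF subspace_span, where R = "1 / norm v"])
    fix y assume "y \<in> span {v}"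
    then show "\<phi> y \<le> 1 / norm v * norm y + 0"
      using assms by (auto simp: span_singleton \<phi>)
  qed (auto simp: span_singleton \<phi> simp flip: scaleR_add_left)
  then obtain h :: "'a \<Rightarrow>\<^sub>L real" where h: "\<And>y. y \<in> span {v} \<Longrightarrow> \<phi> y \<le> h y" by auto
  have "1 \<le> h v" using h[of v] \<phi>[of 1] by (simp add: span_base)
  moreover have "-1 \<le> - h v" using h[of "-v"] \<phi>[of "-1"]
    by (simp add: span_neg span_base blinfun.minus_right)
  ultimately show ?thesis by (intro exI[of _ h]) simp
qed

text \<open>The coordinate functionals live on the whole space, so they can later be composed with
  an operator into \<open>span B\<close>. In the induction the new functional is
  \<open>g (y - P y)\<close>: it vanishes wherever \<open>P\<close> already fixes \<open>y\<close>,
  and it picks up the part \<open>b'\<close> of the new vector that \<open>P\<close> misses.\<close>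

lemma finite_span_retraction:
  fixes B :: "'a::real_normed_vector set"
  assumes "finite B"
  shows "\<exists>(d::nat) (h :: nat \<Rightarrow> 'a \<Rightarrow>\<^sub>L real) e. \<forall>y\<in>span B. y = (\<Sum>i<d. h i y *\<^sub>R e i)"
  using assms
proof (induction B)
  case empty then show ?case by (intro exI[of _ 0]) simp
next
  case (insert b B)
  then obtain d :: nat and h :: "nat \<Rightarrow> 'a \<Rightarrow>\<^sub>L real" and e
    where IH: "\<forall>y\<in>span B. y = (\<Sum>i<d. h i y *\<^sub>R e i)" by blast
  define P where "P = (\<lambda>y. \<Sum>i<d. h i y *\<^sub>R e i)"
  have fix_B: "P y = y" if "y \<in> span B" for y using IH that by (metis P_def)
  have lin: "linear P"
    unfolding P_def by (intro linearI) (auto simp: blinfun.bilinear_simps scaleR_left_distrib sum.distrib scaleR_right.sum)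
  define b' where "b' = b - P b"
  show ?case
  proof (cases "b' = 0")
    case True
    have "y = P y" if y: "y \<in> span (insert b B)" for y
    proof -
      obtain k where k: "y - k *\<^sub>R b \<in> span B" using y by (auto simp: span_breakdown_eq)
      then have "y - k *\<^sub>R b = P y - k *\<^sub>R P b"
        using fix_B[OF k] lin by (simp add: linear_diff linear_scale)
      then show ?thesis using True by (simp add: b'_def)
    qed
    then show ?thesis unfolding P_def by blast
  next
    case False
    then obtain g :: "'a \<Rightarrow>\<^sub>L real" where g: "g b' = 1" using exists_blinfun_eq_1 by blast
    define G where "G = (\<lambda>y. g (y - P y))"
    define f where "f = Blinfun G"
    have "bounded_linear P" unfolding P_def
      by (intro bounded_linear_sum bounded_linear_scaleR_const blinfun.bounded_linear_right)
    then have "bounded_linear G" unfolding G_def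
      by (intro bounded_linear_compose[OF blinfun.bounded_linear_right] bounded_linear_sub bounded_linear_ident)
    then have f: "f y = g (y - P y)" for y by (simp add: f_def G_def bounded_linear_Blinfun_apply)
    define h' where "h' = h(d := f)"
    define e' where "e' = e(d := b')"
    have sum: "(\<Sum>i<Suc d. h' i y *\<^sub>R e' i) = P y + g (y - P y) *\<^sub>R b'" for y
      by (simp add: h'_def e'_def P_def f)
    have "y = P y + g (y - P y) *\<^sub>R b'" if y: "y \<in> span (insert b B)" for y
    proof -
      obtain k where k: "y - k *\<^sub>R b \<in> span B" using y by (auto simp: span_breakdown_eq)
      then have "y - k *\<^sub>R b = P y - k *\<^sub>R P b"
        using fix_B[OF k] lin by (simp add: linear_diff linear_scale)
      then have *: "y - P y = k *\<^sub>R b'" by (simp add: b'_def algebra_simps)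
      have gk: "g (y - P y) = k" unfolding * using g by (simp add: blinfun.scaleR_right)
      show ?thesis unfolding gk *[symmetric] by simp
    qed
    then show ?thesis using sum by metis
  qed
qed

section \<open>Total boundedness, and extension of operators by density\<close>

lemma compact_closure_if_near_compact:
  fixes S :: "'a::complete_space set"
  assumes near: "\<And>e. e > 0 \<Longrightarrow> \<exists>C. compact C \<and> (\<forall>s\<in>S. \<exists>c\<in>C. dist s c \<le> e)"
  shows "compact (closure S)"
  unfolding compact_eq_totally_bounded
proof (intro conjI allI impI)
  show "complete (closure S)" by (simp add: complete_eq_closed)
  fix e :: real assume e: "e > 0"
  obtain C where C: "compact C" "\<And>s. s \<in> S \<Longrightarrow> \<exists>c\<in>C. dist s c \<le> e/4"
    using near[of "e/4"] e by auto
  obtain k where k: "finite k" "C \<subseteq> (\<Union>x\<in>k. ball x (e/4))"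
    using C(1) e unfolding compact_eq_totally_bounded by (metis zero_less_divide_iff zero_less_numeral)
  \<comment> \<open>A finite union of closed balls is closed and so covers \<open>closure S\<close>
    as well; radius \<open>e/2\<close> leaves room for open balls of radius
    \<open>e\<close>.\<close>
  have "S \<subseteq> (\<Union>x\<in>k. cball x (e/2))"
  proof
    fix s assume "s \<in> S"
    then obtain c where c: "c \<in> C" "dist s c \<le> e/4" using C(2) by blast
    then obtain x where "x \<in> k" "dist x c < e/4" using k(2) by auto
    then have "dist x s \<le> e/2" using c(2) dist_triangle2[of x s c] by linarith
    then show "s \<in> (\<Union>x\<in>k. cball x (e/2))" using \<open>x \<in> k\<close> by auto
  qed
  then have "closure S \<subseteq> (\<Union>x\<in>k. cball x (e/2))"
    using k(1) by (intro closure_minimal closed_UN) auto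
  also have "\<dots> \<subseteq> (\<Union>x\<in>k. ball x e)" using e by fastforce
  finally show "\<exists>k. finite k \<and> closure S \<subseteq> (\<Union>x\<in>k. ball x e)" using k(1) by blast
qed

lemma extend_bounded_linear_from_dense:
  fixes D :: "'a::real_normed_vector set" and G :: "'a \<Rightarrow> 'b::banach"
  assumes D: "subspace D" "closure D = UNIV"
    and add: "\<And>x y. x \<in> D \<Longrightarrow> y \<in> D \<Longrightarrow> G (x + y) = G x + G y"
    and scale: "\<And>t x. x \<in> D \<Longrightarrow> G (t *\<^sub>R x) = t *\<^sub>R G x"
    and bound: "\<And>x. x \<in> D \<Longrightarrow> norm (G x) \<le> M * norm x"
  shows "\<exists>T :: 'a \<Rightarrow>\<^sub>L 'b. \<forall>x\<in>D. T x = G x"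
proof -
  have lip: "dist (G x) (G y) \<le> M * dist x y" if "x \<in> D" "y \<in> D" for x y
  proof -
    have "G (x + (-1) *\<^sub>R y) = G x + (-1) *\<^sub>R G y"
      using add[OF that(1) subspace_scale[OF D(1) that(2)]] scale[OF that(2)] by metis
    then show ?thesis
      using bound[OF subspace_diff[OF D(1) that]] by (simp add: dist_norm)
  qed
  have "uniformly_continuous_on D G" unfolding uniformly_continuous_on_def
  proof (intro allI impI)
    fix e :: real assume e: "e > 0"
    \<comment> \<open>Adding 1 keeps the denominator positive for every real
      \<open>M\<close>.\<close>
    define d where "d = e / (\<bar>M\<bar> + 1)"
    have d: "d > 0" using e by (simp add: d_def)
    have "dist (G y) (G x) < e" if "x \<in> D" "y \<in> D" "dist y x < d" for x y
    proof -
      have "dist (G y) (G x) \<le> (\<bar>M\<bar> + 1) * dist y x"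
        using lip[OF that(2,1)] by (smt (verit) mult_right_mono zero_le_dist)
      also have "\<dots> < (\<bar>M\<bar> + 1) * d" using that(3) by (intro mult_strict_left_mono) auto
      also have "\<dots> = e" by (simp add: d_def)
      finally show ?thesis .
    qed
    then show "\<exists>d>0. \<forall>x\<in>D. \<forall>x'\<in>D. dist x' x < d \<longrightarrow> dist (G x') (G x) < e" using d by blast
  qed
  then obtain T where T: "uniformly_continuous_on (closure D) T" "\<And>x. x \<in> D \<Longrightarrow> G x = T x"
    using uniformly_continuous_on_extension_on_closure by metis
  have cont: "isCont T x" for x
    using uniformly_continuous_imp_continuous[OF T(1)] D(2) by (simp add: continuous_on_eq_continuous_at)
  have seq: "\<exists>X. (\<forall>n. X n \<in> D) \<and> X \<longlonglongrightarrow> x" for x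
    using D(2) closure_sequential[of x D] by auto
  have Tadd: "T (x + y) = T x + T y" for x y
  proof -
    obtain X Y where X: "\<And>n. X n \<in> D" "X \<longlonglongrightarrow> x" and Y: "\<And>n. Y n \<in> D" "Y \<longlonglongrightarrow> y"
      using seq by metis
    have "(\<lambda>n. T (X n + Y n)) \<longlonglongrightarrow> T (x + y)"
      by (intro isCont_tendsto_compose[OF cont] tendsto_add X Y)
    moreover have "T (X n + Y n) = T (X n) + T (Y n)" for n
      using add[OF X(1) Y(1), of n n] T(2) X(1) Y(1) subspace_add[OF D(1)] by simp
    moreover have "(\<lambda>n. T (X n) + T (Y n)) \<longlonglongrightarrow> T x + T y"
      by (intro tendsto_add isCont_tendsto_compose[OF cont] X Y)
    ultimately show ?thesis by (simp add: LIMSEQ_unique)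
  qed
  have Tscale: "T (t *\<^sub>R x) = t *\<^sub>R T x" for t x
  proof -
    obtain X where X: "\<And>n. X n \<in> D" "X \<longlonglongrightarrow> x" using seq by metis
    have "(\<lambda>n. T (t *\<^sub>R X n)) \<longlonglongrightarrow> T (t *\<^sub>R x)"
      by (intro isCont_tendsto_compose[OF cont] tendsto_scaleR tendsto_const X)
    moreover have "T (t *\<^sub>R X n) = t *\<^sub>R T (X n)" for n
      using scale[OF X(1), of t n] T(2) X(1) subspace_scale[OF D(1)] by simp
    moreover have "(\<lambda>n. t *\<^sub>R T (X n)) \<longlonglongrightarrow> t *\<^sub>R T x"
      by (intro tendsto_scaleR tendsto_const isCont_tendsto_compose[OF cont] X)
    ultimately show ?thesis by (simp add: LIMSEQ_unique)
  qed
  have Tbound: "norm (T x) \<le> norm x * M" for x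
  proof -
    obtain X where X: "\<And>n. X n \<in> D" "X \<longlonglongrightarrow> x" using seq by metis
    show ?thesis
    proof (rule LIMSEQ_le)
      show "(\<lambda>n. norm (T (X n))) \<longlonglongrightarrow> norm (T x)"
        by (intro tendsto_norm isCont_tendsto_compose[OF cont] X)
      show "(\<lambda>n. norm (X n) * M) \<longlonglongrightarrow> norm x * M"
        by (intro tendsto_mult tendsto_norm tendsto_const X)
      show "\<exists>N. \<forall>n\<ge>N. norm (T (X n)) \<le> norm (X n) * M"
        using bound[OF X(1)] T(2)[OF X(1)] by (simp add: mult.commute)
    qed
  qed
  have "bounded_linear T" using Tadd Tscale Tbound by (rule bounded_linear_intro)
  then show ?thesis using T(2) by (intro exI[of _ "Blinfun T"]) (simp add: bounded_linear_Blinfun_apply)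
qed

section \<open>The fibre norms\<close>

locale willis_sequence =
  fixes x :: "nat \<Rightarrow> 'x::banach"
  assumes x_pos: "\<And>n. 0 < norm (x n)" and x_le1: "\<And>n. norm (x n) \<le> 1"
    and x_lim: "(\<lambda>n. norm (x n)) \<longlonglongrightarrow> 0"
begin

abbreviation "U \<equiv> willis_U x"
abbreviation "Y \<equiv> willis_Y x"
abbreviation "tn \<equiv> willis_tnorm x"

section \<open>The balls \<open>U t\<close> and their linear spans\<close>

definition gen :: "real \<Rightarrow> nat \<Rightarrow> 'x" where
  "gen t n = (1 / (norm (x n) powr t)) *\<^sub>R x n"

lemma U_eq: "U t = closure (convex hull (\<Union>n. {gen t n, - gen t n}))"
  by (simp add: willis_U_def gen_def)

lemma gen_in_U: "gen t n \<in> U t" "- gen t n \<in> U t"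
  unfolding U_eq by (auto intro!: closure_subset[THEN subsetD] hull_inc)

lemma U_closed: "closed (U t)" and U_convex: "convex (U t)"
  by (auto simp: willis_U_def convex_closure)

lemma U_minus: assumes "y \<in> U t" shows "- y \<in> U t"
proof -
  have "closure (convex hull (\<Union>n. {gen t n, - gen t n})) \<subseteq> uminus ` U t"
  proof (intro closure_minimal hull_minimal)
    show "(\<Union>n. {gen t n, - gen t n}) \<subseteq> uminus ` U t"
      using gen_in_U by (force intro: image_eqI[of _ _ "- gen t n" for n])
    show "convex (uminus ` U t)" using U_convex by (rule convex_negations)
    show "closed (uminus ` U t)" using U_closed by (rule closed_negations)
  qed
  then have "y \<in> uminus ` U t" using assms by (auto simp: U_eq)
  then show ?thesis by auto
qed

lemma U_0: "0 \<in> U t"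
  using convexD[OF U_convex gen_in_U(1) gen_in_U(2), of "1/2" "1/2" t 0 0] by simp

lemma U_scale: assumes "y \<in> U t" "\<bar>a\<bar> \<le> 1" shows "a *\<^sub>R y \<in> U t"
proof -
  have *: "b *\<^sub>R z \<in> U t" if "z \<in> U t" "0 \<le> b" "b \<le> 1" for b z
    using convexD[OF U_convex that(1) U_0, of b "1 - b"] that(2,3) by simp
  show ?thesis using *[OF assms(1), of a] *[OF U_minus[OF assms(1)], of "- a"] assms(2) by (cases "a \<ge> 0") auto
qed

text \<open>All comparisons between fibres go through this factor: it is at most 1 for s \<le> t,
  and tends to 0 along the sequence for s < t.\<close>

lemma gen_change: "gen s n = (norm (x n) powr (t - s)) *\<^sub>R gen t n"
  using x_pos[of n] by (simp add: gen_def powr_diff)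

lemma U_mono: assumes "s \<le> t" shows "U s \<subseteq> U t"
  unfolding U_eq[of s]
proof (intro closure_minimal hull_minimal U_closed U_convex)
  have "norm (x n) powr (t - s) \<le> 1" for n
    using powr_mono'[of 0 "t - s" "norm (x n)"] x_pos[of n] x_le1[of n] assms by (simp add: powr_le1)
  then have "gen s n \<in> U t" for n
    using U_scale[OF gen_in_U(1), of "norm (x n) powr (t - s)" t n] by (simp add: gen_change[of s n t])
  then show "(\<Union>n. {gen s n, - gen s n}) \<subseteq> U t" using U_minus by auto
qed

lemma U_norm_le: assumes "y \<in> U t" "t \<le> 1" shows "norm y \<le> 1"
proof -
  \<comment> \<open>At parameter 1 the generators are unit vectors.\<close>
  have "U 1 \<subseteq> cball 0 1" unfolding U_eq
    by (intro closure_minimal hull_minimal) (use x_pos in \<open>auto simp: gen_def powr_one\<close>)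
  then show ?thesis using U_mono[OF assms(2)] assms(1) by auto
qed

text \<open>Since \<open>U t\<close> is convex and symmetric, its positive multiples already form a
  subspace. Hence the set defining the gauge is nonempty on all of \<open>Y t\<close>.\<close>

lemma Y_eq: "Y t = {y. \<exists>l>0. \<exists>u\<in>U t. y = l *\<^sub>R u}"
proof
  show "{y. \<exists>l>0. \<exists>u\<in>U t. y = l *\<^sub>R u} \<subseteq> Y t"
    by (auto simp: willis_Y_def span_scale span_base)
  have "subspace {y. \<exists>l>0. \<exists>u\<in>U t. y = l *\<^sub>R u}"
  proof (rule subspaceI)
    show "0 \<in> {y. \<exists>l>0. \<exists>u\<in>U t. y = l *\<^sub>R u}" using U_0[of t] by (auto intro!: exI[of _ 1])
  next
    fix a y assume "y \<in> {y. \<exists>l>0. \<exists>u\<in>U t. y = l *\<^sub>R u}"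
    then obtain l u where lu: "l > 0" "u \<in> U t" "y = l *\<^sub>R u" by blast
    \<comment> \<open>The factor \<bar>a\<bar> + 1 stays positive when \<open>a = 0\<close>, and
      dividing by it makes the coefficient of \<open>u\<close> a contraction.\<close>
    have "a *\<^sub>R y = (l * (\<bar>a\<bar> + 1)) *\<^sub>R ((a / (\<bar>a\<bar> + 1)) *\<^sub>R u)"
      using lu(3) by (simp add: add_nonneg_eq_0_iff)
    moreover have "(a / (\<bar>a\<bar> + 1)) *\<^sub>R u \<in> U t"
      using lu(2) by (rule U_scale) (simp add: divide_le_eq)
    moreover have "l * (\<bar>a\<bar> + 1) > 0" using lu(1) by (intro mult_pos_pos) auto
    ultimately show "a *\<^sub>R y \<in> {y. \<exists>l>0. \<exists>u\<in>U t. y = l *\<^sub>R u}" by blast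
  next
    fix y z assume "y \<in> {y. \<exists>l>0. \<exists>u\<in>U t. y = l *\<^sub>R u}" "z \<in> {y. \<exists>l>0. \<exists>u\<in>U t. y = l *\<^sub>R u}"
    then obtain l u m w where lu: "l > 0" "u \<in> U t" "y = l *\<^sub>R u" and mw: "m > 0" "w \<in> U t" "z = m *\<^sub>R w" by blast
    have "(l / (l + m)) *\<^sub>R u + (m / (l + m)) *\<^sub>R w \<in> U t"
      using lu mw by (intro convexD[OF U_convex]) (auto simp flip: add_divide_distrib)
    moreover have "y + z = (l + m) *\<^sub>R ((l / (l + m)) *\<^sub>R u + (m / (l + m)) *\<^sub>R w)"
      using lu mw by (simp add: scaleR_add_right)
    ultimately show "y + z \<in> {y. \<exists>l>0. \<exists>u\<in>U t. y = l *\<^sub>R u}" using lu(1) mw(1) by (smt (verit) mem_Collect_eq)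
  qed
  moreover have "U t \<subseteq> {y. \<exists>l>0. \<exists>u\<in>U t. y = l *\<^sub>R u}" by (auto intro!: exI[of _ 1])
  ultimately show "Y t \<subseteq> {y. \<exists>l>0. \<exists>u\<in>U t. y = l *\<^sub>R u}"
    unfolding willis_Y_def by (rule span_minimal[rotated])
qed

lemma Y_subspace: "subspace (Y t)" by (simp add: willis_Y_def)

lemma U_subset_Y: "U t \<subseteq> Y t" by (auto simp: willis_Y_def span_base)

lemma Y_mono: "s \<le> t \<Longrightarrow> Y s \<subseteq> Y t"
  unfolding willis_Y_def by (intro span_mono U_mono)

section \<open>The gauge of \<open>U t\<close> as a norm on \<open>Y t\<close>\<close>

lemma tn_le: assumes "l > 0" "u \<in> U t" shows "tn t (l *\<^sub>R u) \<le> l"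
  unfolding willis_tnorm_def by (rule cInf_lower) (use assms in \<open>auto intro!: bdd_belowI[of _ 0]\<close>)

lemma tn_U: "u \<in> U t \<Longrightarrow> tn t u \<le> 1" using tn_le[of 1 u t] by simp

lemma tn_set_nonempty: "y \<in> Y t \<Longrightarrow> {l. l > 0 \<and> y \<in> (\<lambda>u. l *\<^sub>R u) ` U t} \<noteq> {}"
  by (auto simp: Y_eq)

lemma tn_nonneg: "y \<in> Y t \<Longrightarrow> 0 \<le> tn t y"
  unfolding willis_tnorm_def by (rule cInf_greatest[OF tn_set_nonempty]) auto

text \<open>The admissible factors form an up-set because \<open>U t\<close> is balanced, so every
  \<open>l\<close> strictly above their infimum is admissible.\<close>

lemma tn_less: assumes "y \<in> Y t" "tn t y < l" shows "\<exists>u\<in>U t. y = l *\<^sub>R u"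
proof -
  obtain m where m: "m > 0" "y \<in> (\<lambda>u. m *\<^sub>R u) ` U t" "m < l"
    using cInf_lessD[OF tn_set_nonempty[OF assms(1)]] assms(2) unfolding willis_tnorm_def by blast
  then obtain u where u: "u \<in> U t" "y = m *\<^sub>R u" by blast
  have "(m / l) *\<^sub>R u \<in> U t" by (rule U_scale[OF u(1)]) (use m in \<open>auto simp: divide_le_eq\<close>)
  then show ?thesis using u m by (intro bexI[of _ "(m / l) *\<^sub>R u"]) auto
qed

text \<open>The slack \<open>e\<close> covers the case \<open>l = 0\<close>, which is not itself an
  admissible factor.\<close>

lemma tn_leI: assumes "\<And>e. e > 0 \<Longrightarrow> \<exists>u\<in>U t. y = (l + e) *\<^sub>R u" "l \<ge> 0" shows "tn t y \<le> l"
proof (rule field_le_epsilon)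
  fix e :: real assume e: "e > 0"
  then obtain u where "u \<in> U t" "y = (l + e) *\<^sub>R u" using assms(1) by blast
  then show "tn t y \<le> l + e" using tn_le[of "l + e" u t] assms(2) e by simp
qed

lemma tn_0: "tn t 0 = 0"
proof -
  have "tn t 0 \<le> 0" by (rule tn_leI) (use U_0 in \<open>auto intro!: bexI[of _ 0]\<close>)
  then show ?thesis using tn_nonneg[of 0 t] subspace_0[OF Y_subspace] by fastforce
qed

lemma tn_add: assumes "y \<in> Y t" "z \<in> Y t" shows "tn t (y + z) \<le> tn t y + tn t z"
proof (rule tn_leI)
  fix e :: real assume e: "e > 0"
  define l m where "l = tn t y + e/2" and "m = tn t z + e/2"
  have lm: "l > 0" "m > 0" using tn_nonneg[OF assms(1)] tn_nonneg[OF assms(2)] e by (auto simp: l_def m_def)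
  obtain u w where u: "u \<in> U t" "y = l *\<^sub>R u" and w: "w \<in> U t" "z = m *\<^sub>R w"
    using tn_less[OF assms(1), of l] tn_less[OF assms(2), of m] e by (auto simp: l_def m_def)
  have "(l / (l + m)) *\<^sub>R u + (m / (l + m)) *\<^sub>R w \<in> U t"
    using u w lm by (intro convexD[OF U_convex]) (auto simp flip: add_divide_distrib)
  moreover have "y + z = (l + m) *\<^sub>R ((l / (l + m)) *\<^sub>R u + (m / (l + m)) *\<^sub>R w)"
    using u w lm by (simp add: scaleR_add_right)
  moreover have "l + m = tn t y + tn t z + e" by (simp add: l_def m_def)
  ultimately show "\<exists>u\<in>U t. y + z = (tn t y + tn t z + e) *\<^sub>R u" by metis
qed (use tn_nonneg assms in auto)

lemma tn_scale: assumes "y \<in> Y t" shows "tn t (a *\<^sub>R y) \<le> \<bar>a\<bar> * tn t y"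
proof (cases "a = 0")
  case True then show ?thesis by (simp add: tn_0)
next
  case False
  show ?thesis
  proof (rule tn_leI)
    fix e :: real assume e: "e > 0"
    obtain u where u: "u \<in> U t" "y = (tn t y + e / \<bar>a\<bar>) *\<^sub>R u"
      using tn_less[OF assms, of "tn t y + e / \<bar>a\<bar>"] e False by auto
    have "a *\<^sub>R y = (a * (tn t y + e / \<bar>a\<bar>)) *\<^sub>R u" using u(2) by (metis scaleR_scaleR)
    also have "a * (tn t y + e / \<bar>a\<bar>) = (\<bar>a\<bar> * tn t y + e) * sgn a"
      using False by (auto simp: sgn_if field_simps abs_if)
    also have "\<dots> *\<^sub>R u = (\<bar>a\<bar> * tn t y + e) *\<^sub>R (sgn a *\<^sub>R u)" by simp
    finally have "a *\<^sub>R y = (\<bar>a\<bar> * tn t y + e) *\<^sub>R (sgn a *\<^sub>R u)" .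
    then show "\<exists>u\<in>U t. a *\<^sub>R y = (\<bar>a\<bar> * tn t y + e) *\<^sub>R u"
      using U_scale[OF u(1), of "sgn a"] by (intro bexI[of _ "sgn a *\<^sub>R u"]) (auto simp: sgn_if)
  qed (use tn_nonneg[OF assms] in auto)
qed

lemma tn_sum: assumes "\<And>i. i \<in> I \<Longrightarrow> y i \<in> Y t"
  shows "tn t (\<Sum>i\<in>I. y i) \<le> (\<Sum>i\<in>I. tn t (y i))"
  using assms
proof (induction I rule: infinite_finite_induct)
  case (insert i I)
  then have "(\<Sum>i\<in>I. y i) \<in> Y t" by (intro subspace_sum[OF Y_subspace]) auto
  then show ?case using insert tn_add[of "y i" t "\<Sum>i\<in>I. y i"] by fastforce
qed (auto simp: tn_0)

lemma tn_antimono: assumes "y \<in> Y s" "s \<le> t" shows "tn t y \<le> tn s y"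
proof (rule tn_leI)
  fix e :: real assume "e > 0"
  then obtain u where "u \<in> U s" "y = (tn s y + e) *\<^sub>R u" using tn_less[OF assms(1), of "tn s y + e"] by auto
  then show "\<exists>u\<in>U t. y = (tn s y + e) *\<^sub>R u" using U_mono[OF assms(2)] by blast
qed (use tn_nonneg[OF assms(1)] in auto)

lemma norm_le_tn: assumes "y \<in> Y t" "t \<le> 1" shows "norm y \<le> tn t y"
proof (rule field_le_epsilon)
  fix e :: real assume "e > 0"
  then obtain u where u: "u \<in> U t" "y = (tn t y + e) *\<^sub>R u" using tn_less[OF assms(1), of "tn t y + e"] by auto
  have "norm y = \<bar>tn t y + e\<bar> * norm u" using u(2) by (metis norm_scaleR)
  also have "\<dots> \<le> \<bar>tn t y + e\<bar> * 1" using U_norm_le[OF u(1) assms(2)] by (intro mult_left_mono) auto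
  finally show "norm y \<le> tn t y + e" using tn_nonneg[OF assms(1)] \<open>e > 0\<close> by simp
qed

text \<open>Far out in the sequence the generators of the smaller ball are small multiples of
  those of the larger one.\<close>

lemma U_near_finite_hull:
  assumes st: "s < t" and \<delta>: "\<delta> > 0"
  shows "\<exists>P. finite P \<and> P \<subseteq> U s \<and> (\<forall>y\<in>U s. \<exists>p\<in>convex hull P. \<exists>w\<in>U t. y = p + \<delta> *\<^sub>R w)"
proof -
  have "(\<lambda>n. norm (x n) powr (t - s)) \<longlonglongrightarrow> 0"
    using tendsto_powr2[OF x_lim, of "\<lambda>_. t - s" "t - s"] st by simp
  then have "\<forall>\<^sub>F n in sequentially. norm (x n) powr (t - s) < \<delta>"
    using \<delta> by (rule order_tendstoD)
  then obtain N where N: "\<And>n. n \<ge> N \<Longrightarrow> norm (x n) powr (t - s) < \<delta>"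
    by (auto simp: eventually_sequentially)
  \<comment> \<open>Including 0 lets the distant generators be written as 0 plus \<delta> times a
    point of \<open>U t\<close>.\<close>
  define P where "P = insert 0 (\<Union>n<N. {gen s n, - gen s n})"
  define Q where "Q = (\<Union>p\<in>convex hull P. \<Union>q\<in>(\<lambda>w. \<delta> *\<^sub>R w) ` U t. {p + q})"
  have P: "finite P" "P \<subseteq> U s" using gen_in_U U_0 by (auto simp: P_def)
  have "U s \<subseteq> Q"
    unfolding U_eq[of s]
  proof (intro closure_minimal hull_minimal)
    \<comment> \<open>\<open>Q\<close> is the sum of a compact and a closed set. Being closed and
      convex, it contains \<open>U s\<close> once it contains the generators.\<close>
    show "closed Q" unfolding Q_def
      by (intro compact_closed_sums finite_imp_compact_convex_hull P closed_scaling U_closed)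
    show "convex Q" unfolding Q_def by (intro convex_sums convex_convex_hull convex_scaling U_convex)
    have inQ: "p + \<delta> *\<^sub>R w \<in> Q" if "p \<in> convex hull P" "w \<in> U t" for p w
      using that by (auto simp: Q_def)
    have P0: "0 \<in> convex hull P" by (auto simp: P_def intro: hull_inc)
    have "gen s n \<in> Q \<and> - gen s n \<in> Q" for n
    proof (cases "n < N")
      case True
      then have "gen s n \<in> convex hull P" "- gen s n \<in> convex hull P"
        by (auto simp: P_def intro!: hull_inc)
      then show ?thesis using inQ[OF _ U_0] by force
    next
      case False
      define w where "w = (norm (x n) powr (t - s) / \<delta>) *\<^sub>R gen t n"
      have "w \<in> U t" unfolding w_def
        by (rule U_scale[OF gen_in_U(1)]) (use N[of n] False \<delta> in auto)
      moreover have "gen s n = 0 + \<delta> *\<^sub>R w" using \<delta> by (simp add: w_def gen_change[of s n t])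
      moreover have "- gen s n = 0 + \<delta> *\<^sub>R (- w)" using \<delta> by (simp add: w_def gen_change[of s n t])
      ultimately show ?thesis using inQ[OF P0] U_minus by metis
    qed
    then show "(\<Union>n. {gen s n, - gen s n}) \<subseteq> Q" by auto
  qed
  then have "\<forall>y\<in>U s. \<exists>p\<in>convex hull P. \<exists>w\<in>U t. y = p + \<delta> *\<^sub>R w" by (fastforce simp: Q_def)
  then show ?thesis using P by blast
qed

text \<open>Modulo a small multiple of \<open>U t\<close>, the ball \<open>U s\<close> is a finite
  polytope. Boundedness of \<open>J\<close> for \<open>tn t\<close> turns this into closeness of the
  image to a compact polytope in the target.\<close>

lemma compact_closure_image_U:
  fixes J :: "'x \<Rightarrow> 'z::banach"
  assumes st: "s < t"
    and add: "\<And>y z. y \<in> Y t \<Longrightarrow> z \<in> Y t \<Longrightarrow> J (y + z) = J y + J z"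
    and scale: "\<And>a y. y \<in> Y t \<Longrightarrow> J (a *\<^sub>R y) = a *\<^sub>R J y"
    and bound: "\<And>y. y \<in> Y t \<Longrightarrow> norm (J y) \<le> \<beta> * tn t y"
  shows "compact (closure (J ` U s))"
proof (rule compact_closure_if_near_compact)
  fix e :: real assume e: "e > 0"
  define \<delta> where "\<delta> = e / (\<bar>\<beta>\<bar> + 1)"
  have \<delta>: "\<delta> > 0" using e by (simp add: \<delta>_def)
  obtain P where P: "finite P" "P \<subseteq> U s"
    and near: "\<And>y. y \<in> U s \<Longrightarrow> \<exists>p\<in>convex hull P. \<exists>w\<in>U t. y = p + \<delta> *\<^sub>R w"
    using U_near_finite_hull[OF st \<delta>] by blast
  have PY: "P \<subseteq> Y t" using P(2) U_subset_Y[of s] Y_mono[of s t] st by auto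
  \<comment> \<open>\<open>J\<close> is linear on \<open>Y t\<close> only, so membership in
    \<open>Y t\<close> is carried through the hull argument.\<close>
  have "convex hull P \<subseteq> {y \<in> Y t. J y \<in> convex hull (J ` P)}"
  proof (rule hull_minimal)
    show "P \<subseteq> {y \<in> Y t. J y \<in> convex hull (J ` P)}" using PY by (auto intro: hull_inc)
    show "convex {y \<in> Y t. J y \<in> convex hull (J ` P)}"
      using Y_subspace[of t] convexD[OF convex_convex_hull, of _ "J ` P"]
      by (intro convexI) (auto simp: add scale subspace_add subspace_scale)
  qed
  then have hull: "p \<in> Y t" "J p \<in> convex hull (J ` P)" if "p \<in> convex hull P" for p
    using that by auto
  have "\<exists>c\<in>convex hull (J ` P). dist (J y) c \<le> e" if y: "y \<in> U s" for y
  proof -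
    obtain p w where pw: "p \<in> convex hull P" "w \<in> U t" "y = p + \<delta> *\<^sub>R w" using near[OF y] by blast
    have w: "w \<in> Y t" using pw U_subset_Y by auto
    have "J y = J p + \<delta> *\<^sub>R J w"
      unfolding pw(3) using add[OF hull(1)[OF pw(1)] subspace_scale[OF Y_subspace w]] scale[OF w] by simp
    then have "dist (J y) (J p) = \<delta> * norm (J w)" using \<delta> by (simp add: dist_norm)
    also have "\<dots> \<le> \<delta> * (\<bar>\<beta>\<bar> + 1)"
    proof (rule mult_left_mono)
      have "norm (J w) \<le> \<beta> * tn t w" using bound[OF w] .
      also have "\<dots> \<le> \<bar>\<beta>\<bar> * 1" using tn_U[OF pw(2)] tn_nonneg[OF w] by (intro mult_mono) auto
      finally show "norm (J w) \<le> \<bar>\<beta>\<bar> + 1" by simp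
    qed (use \<delta> in simp)
    also have "\<dots> = e" by (simp add: \<delta>_def)
    finally show ?thesis using hull(2)[OF pw(1)] by blast
  qed
  then show "\<exists>C. compact C \<and> (\<forall>s\<in>J ` U s. \<exists>c\<in>C. dist s c \<le> e)"
    using P(1) by (intro exI[of _ "convex hull (J ` P)"]) (auto intro: finite_imp_compact_convex_hull)
qed

end

section \<open>Step functions and their integrals\<close>

lemma bounded_borel_measurable_imp_integrable_on:
  fixes h :: "real \<Rightarrow> real"
  assumes "h \<in> borel_measurable borel" "\<And>r. r \<in> {a..b} \<Longrightarrow> \<bar>h r\<bar> \<le> M"
  shows "h integrable_on {a..b}"
proof (rule measurable_bounded_by_integrable_imp_integrable_real)
  show "h \<in> borel_measurable (lebesgue_on {a..b})"
    using assms(1) by (simp add: borel_measurable_if_D measurable_completion measurable_restrict_space1)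
  show "(\<lambda>_. M) integrable_on {a..b}" by (rule integrable_const_ivl)
qed (use assms(2) in auto)

lemma has_integral_indicator_Ioo:
  fixes y :: "'a::banach"
  assumes "a \<le> p" "p \<le> q" "q \<le> b"
  shows "((\<lambda>r. indicator {p<..<q} r *\<^sub>R y) has_integral ((q - p) *\<^sub>R y)) {a..b}"
proof -
  have "((\<lambda>_. y) has_integral ((q - p) *\<^sub>R y)) {p<..<q}"
    using has_integral_const_real[of y p q] assms(2) by (simp add: has_integral_Icc_iff_Ioo)
  then have "((\<lambda>r. if r \<in> {p<..<q} then y else 0) has_integral ((q - p) *\<^sub>R y)) {a..b}"
    using assms by (subst has_integral_restrict) auto
  moreover have "(\<lambda>r. if r \<in> {p<..<q} then y else 0) = (\<lambda>r. indicator {p<..<q} r *\<^sub>R y)"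
    by (auto simp: indicator_def)
  ultimately show ?thesis by metis
qed

text \<open>Exactly one indicator is nonzero at \<open>r\<close>, so the identity holds for
  nonlinear \<open>h\<close> too; it serves both for the gauge \<open>tn r\<close> and for
  multiplication by a scalar.\<close>

lemma sum_indicator_partition:
  fixes h :: "'a \<Rightarrow> 'b::real_vector"
  assumes "finite I" "\<exists>S\<in>I. y = w S \<and> (\<forall>S'\<in>I. r \<in> A S' \<longleftrightarrow> S' = S)"
  shows "h y = (\<Sum>S\<in>I. indicator (A S) r *\<^sub>R h (w S))"
proof -
  obtain S where S: "S \<in> I" "y = w S" "\<And>S'. S' \<in> I \<Longrightarrow> r \<in> A S' \<longleftrightarrow> S' = S" using assms(2) by blast
  have "(\<Sum>S\<in>I. indicator (A S) r *\<^sub>R h (w S)) = (\<Sum>S\<in>{S}. indicator (A S) r *\<^sub>R h (w S))"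
    using S assms(1) by (intro sum.mono_neutral_right) auto
  then show ?thesis using S by simp
qed

context willis_sequence
begin

abbreviation "steps \<equiv> willis_steps x"

section \<open>Vector space operations on step functions\<close>

definition bump :: "real \<Rightarrow> real \<Rightarrow> 'x \<Rightarrow> real \<Rightarrow> 'x" where
  "bump p q y = (\<lambda>r. indicator {p<..<q} r *\<^sub>R y)"

lemma bump_in_steps: "0 < p \<Longrightarrow> p < q \<Longrightarrow> q < 1 \<Longrightarrow> y \<in> Y p \<Longrightarrow> bump p q y \<in> steps"
  unfolding willis_steps_def bump_def
  by (rule CollectI, rule exI[of _ "1::nat"], rule exI[of _ "\<lambda>_. p"], rule exI[of _ "\<lambda>_. q"], rule exI[of _ "\<lambda>_. y"]) auto

lemma steps_scale: assumes "f \<in> steps" shows "(\<lambda>r. a *\<^sub>R f r) \<in> steps"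
proof -
  obtain n :: nat and u v y where *: "\<forall>k<n. 0 < u k \<and> u k < v k \<and> v k < 1 \<and> y k \<in> Y (u k)"
    "f = (\<lambda>r. \<Sum>k<n. indicator {u k<..<v k} r *\<^sub>R y k)" using assms by (auto simp: willis_steps_def)
  show ?thesis unfolding willis_steps_def
    by (rule CollectI, rule exI[of _ n], rule exI[of _ u], rule exI[of _ v], rule exI[of _ "\<lambda>k. a *\<^sub>R y k"])
       (use * in \<open>auto simp: scaleR_sum_right scaleR_left_commute[of a] subspace_scale[OF Y_subspace]
          simp del: sum_indicator_scaleR scaleR_scaleR\<close>)
qed

lemma steps_add: assumes "f \<in> steps" "g \<in> steps" shows "(\<lambda>r. f r + g r) \<in> steps"
proof -
  obtain n :: nat and u v y where *: "\<forall>k<n. 0 < u k \<and> u k < v k \<and> v k < 1 \<and> y k \<in> Y (u k)"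
    "f = (\<lambda>r. \<Sum>k<n. indicator {u k<..<v k} r *\<^sub>R y k)" using assms by (auto simp: willis_steps_def)
  obtain n' :: nat and u' v' y' where **: "\<forall>k<n'. 0 < u' k \<and> u' k < v' k \<and> v' k < 1 \<and> y' k \<in> Y (u' k)"
    "g = (\<lambda>r. \<Sum>k<n'. indicator {u' k<..<v' k} r *\<^sub>R y' k)" using assms by (auto simp: willis_steps_def)
  \<comment> \<open>The summands of \<open>g\<close> are listed after those of \<open>f\<close>,
    with their indices shifted by \<open>n\<close>.\<close>
  let ?u = "\<lambda>k. if k < n then u k else u' (k - n)"
  let ?v = "\<lambda>k. if k < n then v k else v' (k - n)"
  let ?y = "\<lambda>k. if k < n then y k else y' (k - n)"
  have split: "(\<Sum>k<n + n'. h k) = (\<Sum>k<n. h k) + (\<Sum>k<n'. h (k + n))" for h :: "nat \<Rightarrow> 'x"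
    using sum.atLeastLessThan_concat[of 0 n "n + n'" h] sum.shift_bounds_nat_ivl[of h 0 n n']
    by (simp add: atLeast0LessThan add.commute)
  show ?thesis unfolding willis_steps_def
    by (rule CollectI, rule exI[of _ "n + n'"], rule exI[of _ ?u], rule exI[of _ ?v], rule exI[of _ ?y])
       (use * ** in \<open>auto simp: split\<close>)
qed

text \<open>The pieces on which a step function is constant, indexed by the set of summands that are
  active there.\<close>

lemma steps_partition:
  assumes "f \<in> steps"
  obtains I :: "nat set set" and A w m where
    "finite I" "\<And>S. S \<in> I \<Longrightarrow> A S \<in> sets borel" "\<And>S. S \<in> I \<Longrightarrow> w S \<in> Y (m S)"
    "\<And>S r. S \<in> I \<Longrightarrow> r \<in> A S \<Longrightarrow> m S \<le> r"
    "\<And>r. r \<in> {0..1} \<Longrightarrow> \<exists>S\<in>I. f r = w S \<and> (\<forall>S'\<in>I. r \<in> A S' \<longleftrightarrow> S' = S)"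
proof -
  obtain n :: nat and u v y where *: "\<And>k. k < n \<Longrightarrow> 0 < u k \<and> u k < v k \<and> v k < 1 \<and> y k \<in> Y (u k)"
    and f: "f = (\<lambda>r. \<Sum>k<n. indicator {u k<..<v k} r *\<^sub>R y k)" using assms by (auto simp: willis_steps_def)
  define I where "I = Pow {..<n}"
  define act where "act = (\<lambda>r. {k. k < n \<and> r \<in> {u k<..<v k}})"
  define A where "A = (\<lambda>S. {0..1} \<inter> {r. act r = S})"
  define w where "w = (\<lambda>S. \<Sum>k\<in>S. y k)"
  \<comment> \<open>The largest active left endpoint: by monotonicity every active
    \<open>y k\<close> lies in its fibre, and it is at most \<open>r\<close> on the piece. For no
    active summand the vector is 0 and any parameter works; 0 is below all of
    \<open>{0..1}\<close>.\<close>
  define m where "m = (\<lambda>S. if S = {} then 0 else Max (u ` S))"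
  have fin: "finite S" if "S \<in> I" for S using that finite_subset by (auto simp: I_def)
  have "A S \<in> sets borel" if "S \<in> I" for S
  proof -
    have "A S = {0..1} \<inter> {r. \<forall>k<n. r \<in> {u k<..<v k} \<longleftrightarrow> k \<in> S}"
      using that by (auto simp: A_def act_def I_def)
    then show ?thesis by simp
  qed
  moreover have "w S \<in> Y (m S)" if "S \<in> I" for S
    unfolding w_def
  proof (intro subspace_sum[OF Y_subspace])
    fix k assume k: "k \<in> S"
    then have "u k \<le> m S" using fin[OF that] by (auto simp: m_def)
    then show "y k \<in> Y (m S)" using *[of k] k that Y_mono by (auto simp: I_def)
  qed
  moreover have "m S \<le> r" if "S \<in> I" "r \<in> A S" for S r
  proof -
    have "0 \<le> r" "act r = S" using that(2) by (auto simp: A_def)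
    moreover have "u k \<le> r" if "k \<in> act r" for k using that by (auto simp: act_def)
    ultimately show ?thesis using fin[OF that(1)] by (auto simp: m_def)
  qed
  moreover have "\<exists>S\<in>I. f r = w S \<and> (\<forall>S'\<in>I. r \<in> A S' \<longleftrightarrow> S' = S)" if r: "r \<in> {0..1}" for r
  proof -
    have "f r = w (act r)"
      unfolding f w_def act_def by (rule sum.mono_neutral_cong_right) (auto simp: indicator_def)
    moreover have "act r \<in> I" by (auto simp: act_def I_def)
    ultimately show ?thesis using r by (intro bexI[of _ "act r"]) (auto simp: A_def)
  qed
  ultimately show ?thesis using that[of I A w m] by (simp add: I_def)
qed

text \<open>On each constancy piece the integrals reduce to scalar ones. For the last claim,
  \<open>tn t\<close> is at most \<open>tn r\<close> wherever \<open>g\<close> is nonzero, so the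
  triangle inequality for the finite sum of vector coefficients gives the norm bound in the single
  fibre \<open>Y t\<close>.\<close>

lemma steps_integral:
  assumes f: "f \<in> steps" and g: "g \<in> borel_measurable borel" and gM: "\<And>r. \<bar>g r\<bar> \<le> M"
  shows "(\<lambda>r. tn r (f r)) integrable_on {0..1}"
    and "(\<lambda>r. g r *\<^sub>R f r) integrable_on {0..1}"
    and "(\<And>r. g r \<noteq> 0 \<Longrightarrow> r \<le> t) \<Longrightarrow> integral {0..1} (\<lambda>r. g r *\<^sub>R f r) \<in> Y t \<and>
      tn t (integral {0..1} (\<lambda>r. g r *\<^sub>R f r)) \<le> M * willis_norm x f"
proof -
  obtain I :: "nat set set" and A w m where I: "finite I"
    and A: "\<And>S. S \<in> I \<Longrightarrow> A S \<in> sets borel" and w: "\<And>S. S \<in> I \<Longrightarrow> w S \<in> Y (m S)"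
    and m: "\<And>S r. S \<in> I \<Longrightarrow> r \<in> A S \<Longrightarrow> m S \<le> r"
    and part: "\<And>r. r \<in> {0..1} \<Longrightarrow> \<exists>S\<in>I. f r = w S \<and> (\<forall>S'\<in>I. r \<in> A S' \<longleftrightarrow> S' = S)"
    by (rule steps_partition[OF f]) (rule that)
  have dec: "h (f r) = (\<Sum>S\<in>I. indicator (A S) r * h (w S))" if "r \<in> {0..1}" for r and h :: "'x \<Rightarrow> real"
    using sum_indicator_partition[OF I part[OF that], of h] by simp
  have M0: "M \<ge> 0" using gM[of 0] by linarith
  \<comment> \<open>Clamping the parameter at \<open>m S\<close> keeps \<open>w S\<close> in the
    relevant fibre for every real \<open>r\<close>, which makes the gauge globally monotone; on
    \<open>A S\<close> the clamped parameter is \<open>r\<close> itself.\<close>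
  define N where "N = (\<lambda>S r. indicator (A S) r * tn (max r (m S)) (w S))"
  have wY: "w S \<in> Y (max r (m S))" if "S \<in> I" for S r using w[OF that] Y_mono[of "m S" "max r (m S)"] by auto
  have N0: "N S r \<ge> 0" if "S \<in> I" for S r using tn_nonneg[OF wY[OF that]] by (simp add: N_def)
  have N_int: "N S integrable_on {0..1}" if S: "S \<in> I" for S
  proof (rule bounded_borel_measurable_imp_integrable_on)
    \<comment> \<open>Measurability comes from monotonicity: the gauge decreases in its
      parameter.\<close>
    have "mono (\<lambda>r. - tn (max r (m S)) (w S))"
      by (intro monoI) (use tn_antimono[OF wY[OF S]] in auto)
    then have "(\<lambda>r. - (- tn (max r (m S)) (w S))) \<in> borel_measurable borel"
      by (intro borel_measurable_uminus borel_measurable_mono)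
    then show "N S \<in> borel_measurable borel"
      unfolding N_def using A[OF S] by simp
    show "\<bar>N S r\<bar> \<le> tn (m S) (w S)" for r
      using tn_antimono[OF w[OF S], of "max r (m S)"] tn_nonneg[OF w[OF S]] tn_nonneg[OF wY[OF S], of r]
      by (auto simp: N_def indicator_def)
  qed
  have tn_eq: "tn r (f r) = (\<Sum>S\<in>I. N S r)" if "r \<in> {0..1}" for r
  proof -
    have "tn r (f r) = (\<Sum>S\<in>I. indicator (A S) r * tn r (w S))" using dec[OF that] .
    also have "\<dots> = (\<Sum>S\<in>I. N S r)"
      by (rule sum.cong) (auto simp: N_def indicator_def max_absorb1 m)
    finally show ?thesis .
  qed
  have sumN: "((\<lambda>r. \<Sum>S\<in>I. N S r) has_integral (\<Sum>S\<in>I. integral {0..1} (N S))) {0..1}"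
    by (intro has_integral_sum I integrable_integral N_int)
  then have normf: "((\<lambda>r. tn r (f r)) has_integral (\<Sum>S\<in>I. integral {0..1} (N S))) {0..1}"
    by (rule has_integral_eq[rotated]) (simp add: tn_eq)
  then show "(\<lambda>r. tn r (f r)) integrable_on {0..1}" by blast
  have wn: "willis_norm x f = (\<Sum>S\<in>I. integral {0..1} (N S))"
    unfolding willis_norm_def using normf by (rule integral_unique)
  define h where "h = (\<lambda>S r. indicator (A S) r * g r)"
  define c where "c = (\<lambda>S. integral {0..1} (h S))"
  have h_int: "h S integrable_on {0..1}" if "S \<in> I" for S
    by (rule bounded_borel_measurable_imp_integrable_on[where M = M])
       (use A[OF that] g gM M0 in \<open>auto simp: h_def indicator_def\<close>)
  have "((\<lambda>r. \<Sum>S\<in>I. h S r *\<^sub>R w S) has_integral (\<Sum>S\<in>I. c S *\<^sub>R w S)) {0..1}"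
    unfolding c_def by (intro has_integral_sum I has_integral_scaleR_left integrable_integral h_int)
  moreover have "(\<Sum>S\<in>I. h S r *\<^sub>R w S) = g r *\<^sub>R f r" if "r \<in> {0..1}" for r
    using sum_indicator_partition[OF I part[OF that], of "\<lambda>y. g r *\<^sub>R y"] by (simp add: h_def)
  ultimately have gf: "((\<lambda>r. g r *\<^sub>R f r) has_integral (\<Sum>S\<in>I. c S *\<^sub>R w S)) {0..1}"
    by (rule has_integral_eq[rotated])
  then show "(\<lambda>r. g r *\<^sub>R f r) integrable_on {0..1}" by blast
  assume gt: "\<And>r. g r \<noteq> 0 \<Longrightarrow> r \<le> t"
  have piece: "c S *\<^sub>R w S \<in> Y t \<and> tn t (c S *\<^sub>R w S) \<le> M * integral {0..1} (N S)" if S: "S \<in> I" for S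
  \<comment> \<open>If \<open>g\<close> is nonzero somewhere on the piece, then m S \<le> r \<le> t
    there, which puts \<open>w S\<close> in \<open>Y t\<close>; otherwise the coefficient
    \<open>c S\<close> vanishes.\<close>
  proof (cases "\<exists>r\<in>A S. g r \<noteq> 0")
    case True
    then have "m S \<le> t" using m[OF S] gt by force
    then have wt: "w S \<in> Y t" using w[OF S] Y_mono by blast
    have "\<bar>c S\<bar> * tn t (w S) = norm (integral {0..1} (\<lambda>r. h S r * tn t (w S)))"
      using tn_nonneg[OF wt] by (simp add: c_def abs_mult)
    also have "\<dots> \<le> integral {0..1} (\<lambda>r. M * N S r)"
    proof (rule Henstock_Kurzweil_Integration.integral_norm_bound_integral)
      show "(\<lambda>r. h S r * tn t (w S)) integrable_on {0..1}"
        using integrable_on_scaleR_left[OF h_int[OF S], of "tn t (w S)"] by simp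
      show "(\<lambda>r. M * N S r) integrable_on {0..1}"
        using integrable_cmul[OF N_int[OF S], of M] by simp
      fix r :: real
      show "norm (h S r * tn t (w S)) \<le> M * N S r"
      proof (cases "r \<in> A S \<and> g r \<noteq> 0")
        case True
        then have mr: "m S \<le> r" "r \<le> t" using m[OF S] gt by auto
        have wr: "w S \<in> Y r" using w[OF S] Y_mono[OF mr(1)] by auto
        have "\<bar>g r\<bar> * tn t (w S) \<le> M * tn r (w S)"
          using gM M0 tn_antimono[OF wr mr(2)] tn_nonneg[OF wt] by (intro mult_mono) auto
        then show ?thesis using True mr(1) tn_nonneg[OF wt] by (simp add: h_def N_def abs_mult max_def)
      next
        case False
        then show ?thesis using M0 N0[OF S] by (auto simp: h_def)
      qed
    qed
    also have "\<dots> = M * integral {0..1} (N S)" by simp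
    finally show ?thesis
      using tn_scale[OF wt, of "c S"] subspace_scale[OF Y_subspace wt] by fastforce
  next
    case False
    then have "h S = (\<lambda>_. 0)" by (auto simp: h_def indicator_def)
    then have "c S = 0" by (simp add: c_def)
    moreover have "integral {0..1} (N S) \<ge> 0"
      using N_int[OF S] N0[OF S] by (intro integral_nonneg) auto
    ultimately show ?thesis using M0 subspace_0[OF Y_subspace] by (simp add: tn_0)
  qed
  have "integral {0..1} (\<lambda>r. g r *\<^sub>R f r) = (\<Sum>S\<in>I. c S *\<^sub>R w S)" using gf by (rule integral_unique)
  moreover have "(\<Sum>S\<in>I. c S *\<^sub>R w S) \<in> Y t" using piece by (intro subspace_sum[OF Y_subspace]) auto
  moreover have "tn t (\<Sum>S\<in>I. c S *\<^sub>R w S) \<le> (\<Sum>S\<in>I. M * integral {0..1} (N S))"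
    using tn_sum[of I "\<lambda>S. c S *\<^sub>R w S" t] sum_mono[of I "\<lambda>S. tn t (c S *\<^sub>R w S)" "\<lambda>S. M * integral {0..1} (N S)"] piece
    by fastforce
  ultimately show "integral {0..1} (\<lambda>r. g r *\<^sub>R f r) \<in> Y t \<and>
      tn t (integral {0..1} (\<lambda>r. g r *\<^sub>R f r)) \<le> M * willis_norm x f"
    by (simp add: wn sum_distrib_left)
qed

text \<open>Between \<open>p\<close> and \<open>q\<close> the gauge of \<open>y\<close> lies between
  its values at the two endpoints, since it decreases in the parameter.\<close>

lemma willis_norm_bump:
  assumes pq: "0 < p" "p < q" "q < 1" and y: "y \<in> Y p"
  shows "willis_norm x (bump p q y) \<le> (q - p) * tn p y"
    and "(q - p) * tn q y \<le> willis_norm x (bump p q y)"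
proof -
  have int: "(\<lambda>r. tn r (bump p q y r)) integrable_on {0..1}"
    using bump_in_steps[OF pq y] by (rule steps_integral(1)[where g = "\<lambda>_. 0" and M = 0]) auto
  have const: "((\<lambda>r. indicator {p<..<q} r *\<^sub>R k) has_integral ((q - p) *\<^sub>R k)) {0..1}" for k :: real
    using pq by (intro has_integral_indicator_Ioo) auto
  have int_const: "integral {0..1} (\<lambda>r. indicator {p<..<q} r *\<^sub>R k) = (q - p) * k" for k :: real
    using integral_unique[OF const[of k]] by (simp only: real_scaleR_def)
  have "willis_norm x (bump p q y) \<le> integral {0..1} (\<lambda>r. indicator {p<..<q} r *\<^sub>R tn p y)"
    unfolding willis_norm_def using int
  proof (rule integral_le)
    show "(\<lambda>r. indicator {p<..<q} r *\<^sub>R tn p y) integrable_on {0..1}" using const by blast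
    show "tn r (bump p q y r) \<le> indicator {p<..<q} r *\<^sub>R tn p y" for r
      using tn_antimono[OF y, of r] by (auto simp: bump_def indicator_def tn_0)
  qed
  then show "willis_norm x (bump p q y) \<le> (q - p) * tn p y" by (simp only: int_const)
  have "integral {0..1} (\<lambda>r. indicator {p<..<q} r *\<^sub>R tn q y) \<le> willis_norm x (bump p q y)"
    unfolding willis_norm_def
  proof (rule integral_le[OF _ int])
    show "(\<lambda>r. indicator {p<..<q} r *\<^sub>R tn q y) integrable_on {0..1}" using const by blast
    show "indicator {p<..<q} r *\<^sub>R tn q y \<le> tn r (bump p q y r)" for r
    proof (cases "r \<in> {p<..<q}")
      case True
      then have "y \<in> Y r" using y Y_mono[of p r] by auto
      then show ?thesis using True tn_antimono[of y r q] by (simp add: bump_def)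
    qed (simp add: bump_def tn_0)
  qed
  then show "(q - p) * tn q y \<le> willis_norm x (bump p q y)" by (simp only: int_const)
qed

end

section \<open>Approximation of functionals\<close>

text \<open>The completion is represented by a linear isometry \<open>j\<close> onto a dense subset
  of a Banach space. Step functions whose difference has norm 0 are identified by
  \<open>j\<close>.\<close>

locale willis_space = willis_sequence x for x :: "nat \<Rightarrow> 'x::banach" +
  fixes j :: "(real \<Rightarrow> 'x) \<Rightarrow> 'z::banach"
  assumes j_add: "\<And>f g. f \<in> willis_steps x \<Longrightarrow> g \<in> willis_steps x \<Longrightarrow> j (\<lambda>r. f r + g r) = j f + j g"
    and j_scale: "\<And>a f. f \<in> willis_steps x \<Longrightarrow> j (\<lambda>r. a *\<^sub>R f r) = a *\<^sub>R j f"
    and j_isometry: "\<And>f. f \<in> willis_steps x \<Longrightarrow> norm (j f) = willis_norm x f"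
    and j_dense: "closure (j ` willis_steps x) = UNIV"
begin

section \<open>Constant functions on an interval as elements of the completion\<close>

definition E :: "real \<Rightarrow> real \<Rightarrow> 'x \<Rightarrow> 'z" where "E p q y = j (bump p q y)"

lemma
  assumes pq: "0 < p" "p < q" "q < 1" and y: "y \<in> Y p"
  shows E_add: "z \<in> Y p \<Longrightarrow> E p q (y + z) = E p q y + E p q z"
    and E_scale: "E p q (a *\<^sub>R y) = a *\<^sub>R E p q y"
    and E_norm_le: "norm (E p q y) \<le> (q - p) * tn p y"
    and E_norm_ge: "(q - p) * tn q y \<le> norm (E p q y)"
proof -
  show "E p q (y + z) = E p q y + E p q z" if "z \<in> Y p"
    using j_add[OF bump_in_steps[OF pq y] bump_in_steps[OF pq that]]
    by (simp add: E_def bump_def scaleR_add_right)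
  show "E p q (a *\<^sub>R y) = a *\<^sub>R E p q y"
    using j_scale[OF bump_in_steps[OF pq y], of a] by (simp add: E_def bump_def mult.commute)
  show "norm (E p q y) \<le> (q - p) * tn p y" "(q - p) * tn q y \<le> norm (E p q y)"
    using willis_norm_bump[OF pq y] j_isometry[OF bump_in_steps[OF pq y]] by (auto simp: E_def)
qed

section \<open>Passing from step functions to the completion\<close>

lemma steps_0: "(\<lambda>r. 0) \<in> steps"
  using bump_in_steps[of "1/3" "1/2" 0] subspace_0[OF Y_subspace] by (simp add: bump_def)

lemma j_image_subspace: "subspace (j ` steps)"
proof (rule subspaceI)
  show "0 \<in> j ` steps" using j_scale[OF steps_0, of 0] steps_0 by (intro image_eqI[of _ _ "\<lambda>r. 0"]) auto
  show "y + z \<in> j ` steps" if yz: "y \<in> j ` steps" "z \<in> j ` steps" for y z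
  proof -
    obtain f g where "f \<in> steps" "g \<in> steps" "y = j f" "z = j g" using yz by blast
    then show ?thesis using j_add[of f g] steps_add[of f g] by (metis imageI)
  qed
  show "a *\<^sub>R y \<in> j ` steps" if y: "y \<in> j ` steps" for a y
  proof -
    obtain f where "f \<in> steps" "y = j f" using y by blast
    then show ?thesis using j_scale[of f a] steps_scale[of f a] by (metis imageI)
  qed
qed

lemma extend_from_steps:
  fixes G :: "(real \<Rightarrow> 'x) \<Rightarrow> 'w::banach"
  assumes add: "\<And>f g. f \<in> steps \<Longrightarrow> g \<in> steps \<Longrightarrow> G (\<lambda>r. f r + g r) = G f + G g"
    and scale: "\<And>a f. f \<in> steps \<Longrightarrow> G (\<lambda>r. a *\<^sub>R f r) = a *\<^sub>R G f"
    and bound: "\<And>f. f \<in> steps \<Longrightarrow> norm (G f) \<le> M * norm (j f)"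
  shows "\<exists>T :: 'z \<Rightarrow>\<^sub>L 'w. \<forall>f\<in>steps. T (j f) = G f"
proof -
  have wd: "G f = G g" if "f \<in> steps" "g \<in> steps" "j f = j g" for f g
  proof -
    define h where "h = (\<lambda>r. f r + (-1) *\<^sub>R g r)"
    have g': "(\<lambda>r. (-1) *\<^sub>R g r) \<in> steps" using steps_scale[OF that(2)] .
    have h: "h \<in> steps" unfolding h_def using steps_add[OF that(1) g'] .
    have "j h = 0" unfolding h_def using j_add[OF that(1) g'] j_scale[OF that(2), of "-1"] that(3) by simp
    moreover have "G h = G f - G g"
      unfolding h_def using add[OF that(1) g'] scale[OF that(2), of "-1"] by simp
    ultimately show ?thesis using bound[OF h] by simp
  qed
  \<comment> \<open>The choice of preimage is immaterial by \<open>wd\<close>.\<close>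
  define H where "H = (\<lambda>z. G (SOME f. f \<in> steps \<and> j f = z))"
  have H: "H (j f) = G f" if "f \<in> steps" for f
  proof -
    have "(SOME g. g \<in> steps \<and> j g = j f) \<in> steps \<and> j (SOME g. g \<in> steps \<and> j g = j f) = j f"
      by (rule someI[of _ f]) (simp add: that)
    then show ?thesis unfolding H_def using wd that by blast
  qed
  have "\<exists>T :: 'z \<Rightarrow>\<^sub>L 'w. \<forall>z\<in>j ` steps. T z = H z"
  proof (rule extend_bounded_linear_from_dense[OF j_image_subspace j_dense])
    show "H (y + z) = H y + H z" if yz: "y \<in> j ` steps" "z \<in> j ` steps" for y z
    proof -
      obtain f g where "f \<in> steps" "g \<in> steps" "y = j f" "z = j g" using yz by blast
      then show ?thesis using j_add[of f g] H[OF steps_add[of f g]] H add by metis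
    qed
    show "H (a *\<^sub>R y) = a *\<^sub>R H y" if y: "y \<in> j ` steps" for a y
    proof -
      obtain f where "f \<in> steps" "y = j f" using y by blast
      then show ?thesis using j_scale[of f a] H[OF steps_scale[of f a]] H scale by metis
    qed
    show "norm (H y) \<le> M * norm y" if "y \<in> j ` steps" for y using that H bound by auto
  qed
  then show ?thesis using H by auto
qed

lemma norm_blinfun_le_on_steps:
  fixes T :: "'z \<Rightarrow>\<^sub>L 'w::real_normed_vector"
  assumes "\<And>f. f \<in> steps \<Longrightarrow> norm (T (j f)) \<le> M * norm (j f)" "M \<ge> 0"
  shows "norm T \<le> M"
proof (rule norm_blinfun_bound[OF assms(2)])
  fix z
  have "closed {z. norm (T z) \<le> M * norm z}" by (intro closed_Collect_le continuous_intros)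
  then have "closure (j ` steps) \<subseteq> {z. norm (T z) \<le> M * norm z}"
    using assms(1) by (intro closure_minimal) auto
  then show "norm (T z) \<le> M * norm z" using j_dense by auto
qed

lemma blinfun_eq_on_steps:
  fixes S T :: "'z \<Rightarrow>\<^sub>L 'w::real_normed_vector"
  assumes "\<And>f. f \<in> steps \<Longrightarrow> S (j f) = T (j f)"
  shows "S = T"
  using norm_blinfun_le_on_steps[of "S - T" 0] assms by (simp add: blinfun.diff_left)

text \<open>Total boundedness of \<open>U 0\<close> in the norm \<open>tn s\<close>: a piece of small \<open>tn s\<close>-diameter either
  has \<open>0\<close> in its closure, and is then small for \<open>tn s\<close> since \<open>U s\<close> is closed, or it stays away
  from \<open>0\<close> in \<open>X\<close>. The lower norm bound of \<open>E\<close> transfers the covering from \<open>Z\<close>.\<close>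

lemma tn_le_norm_plus:
  assumes s: "0 < s" "s < 1" and \<eta>: "\<eta> > 0"
  shows "\<exists>R\<ge>0. \<forall>y\<in>Y 0. tn s y \<le> R * norm y + \<eta> * tn 0 y"
proof -
  \<comment> \<open>A parameter strictly between 0 and \<open>s\<close>: the gap above 0 makes the
    image of \<open>U 0\<close> under \<open>E p s\<close> relatively compact, and the right
    endpoint \<open>s\<close> makes its lower bound speak about \<open>tn s\<close>.\<close>
  define p where "p = s / 2"
  have p: "0 < p" "p < s" using s by (auto simp: p_def)
  have U0p: "U 0 \<subseteq> Y p" using U_subset_Y[of 0] Y_mono[of 0 p] p by auto
  have "compact (closure (E p s ` U 0))"
    by (rule compact_closure_image_U[OF p(1)]) (use E_add E_scale E_norm_le p s in auto)
  \<comment> \<open>Two points of one ball differ by less than \<open>2 * \<rho>\<close> in the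
    completion, hence by less than \<open>\<eta> / 2\<close> in \<open>tn s\<close>.\<close>
  define \<rho> where "\<rho> = (s - p) * \<eta> / 4"
  have \<rho>_eq: "2 * \<rho> = (s - p) * (\<eta> / 2)" by (simp add: \<rho>_def)
  have \<rho>: "\<rho> > 0" using p \<eta> by (simp add: \<rho>_def)
  obtain k where k: "finite k" "closure (E p s ` U 0) \<subseteq> (\<Union>z\<in>k. ball z \<rho>)"
    using \<open>compact _\<close> \<rho> unfolding compact_eq_totally_bounded by meson
  define D where "D = (\<lambda>z. {y \<in> U 0. E p s y \<in> ball z \<rho>})"
  have "\<exists>R\<ge>0. \<forall>y\<in>D z. tn s y \<le> R * norm y + \<eta>" for z
  proof (cases "0 \<in> closure (D z)")
    case True
    have "tn s y \<le> \<eta>" if y: "y \<in> D z" for y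
    proof -
      \<comment> \<open>\<open>Q\<close> is y - \<eta> U_s. It is closed in \<open>X\<close> and
        contains the whole piece, hence also 0.\<close>
      define Q where "Q = (\<lambda>w. y + w) ` ((\<lambda>u. (- \<eta>) *\<^sub>R u) ` U s)"
      have "closed Q" unfolding Q_def
        by (intro closed_translation closed_scaling U_closed)
      moreover have "D z \<subseteq> Q"
      proof
        fix y' assume y': "y' \<in> D z"
        have yp: "y \<in> Y p" "y' \<in> Y p" using y y' U0p by (auto simp: D_def)
        note Yp = yp subspace_neg[OF Y_subspace yp(2)] subspace_diff[OF Y_subspace yp]
        have "E p s (y - y') = E p s y - E p s y'"
          using E_add[OF p s(2) Yp(1,3)] E_scale[OF p s(2) Yp(2), of "-1"] by simp
        then have "norm (E p s (y - y')) < 2 * \<rho>"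
          using y y' dist_triangle2[of "E p s y" "E p s y'" z] by (simp add: D_def dist_norm norm_minus_commute)
        then have "(s - p) * tn s (y - y') < (s - p) * (\<eta> / 2)"
          using E_norm_ge[OF p s(2) Yp(4)] \<rho>_eq by linarith
        then have "tn s (y - y') < \<eta>" using p \<eta> by simp
        moreover have "y - y' \<in> Y s" using Yp(4) Y_mono[of p s] p by auto
        ultimately obtain u where "u \<in> U s" "y - y' = \<eta> *\<^sub>R u" using tn_less by blast
        then show "y' \<in> Q" unfolding Q_def
          by (intro image_eqI[of _ _ "y' - y"] image_eqI[of _ _ u]) (auto simp: algebra_simps)
      qed
      ultimately have "0 \<in> Q" using True closure_minimal by blast
      then obtain u where "u \<in> U s" "y = \<eta> *\<^sub>R u" by (auto simp: Q_def)
      then show ?thesis using tn_le \<eta> by blast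
    qed
    then show ?thesis by (intro exI[of _ 0]) auto
  next
    case False
    then obtain r where r: "r > 0" "\<And>y. y \<in> D z \<Longrightarrow> r \<le> norm y"
      unfolding closure_approachable by (auto simp: dist_norm not_less)
    \<comment> \<open>Away from 0 the crude bound \<open>tn s y \<le> 1\<close> on
      \<open>U 0\<close> is absorbed by the norm of \<open>X\<close>.\<close>
    have "tn s y \<le> 1 / r * norm y + \<eta>" if "y \<in> D z" for y
    proof -
      have "tn s y \<le> 1" using that U_mono[of 0 s] s tn_U by (auto simp: D_def)
      also have "\<dots> \<le> 1 / r * norm y" using r that by (simp add: field_simps)
      finally show ?thesis using \<eta> by simp
    qed
    then show ?thesis using r(1) by (intro exI[of _ "1 / r"]) auto
  qed
  then obtain Rf where Rf: "\<And>z. Rf z \<ge> 0" "\<And>z y. y \<in> D z \<Longrightarrow> tn s y \<le> Rf z * norm y + \<eta>" by metis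
  define R where "R = (\<Sum>z\<in>k. Rf z)"
  have R0: "R \<ge> 0" using Rf(1) by (auto simp: R_def intro: sum_nonneg)
  have onU: "tn s u \<le> R * norm u + \<eta>" if u: "u \<in> U 0" for u
  proof -
    have "E p s u \<in> closure (E p s ` U 0)"
      by (rule subsetD[OF closure_subset imageI[OF u]])
    with k(2) have "E p s u \<in> (\<Union>z\<in>k. ball z \<rho>)" by (rule subsetD)
    with u obtain z where z: "z \<in> k" "u \<in> D z" unfolding D_def by (elim UN_E) simp
    have "Rf z \<le> R" unfolding R_def using k(1) z(1) Rf(1) by (intro member_le_sum) auto
    then have "Rf z * norm u \<le> R * norm u" by (intro mult_right_mono) auto
    then show ?thesis using Rf(2)[OF z(2)] by linarith
  qed
  have "tn s y \<le> R * norm y + \<eta> * tn 0 y" if y: "y \<in> Y 0" for y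
  proof (rule field_le_epsilon)
    fix e :: real assume e: "e > 0"
    \<comment> \<open>Chosen so that \<open>\<eta> * l\<close> exceeds
      \<open>\<eta> * tn 0 y\<close> by exactly \<open>e\<close>.\<close>
    define l where "l = tn 0 y + e / \<eta>"
    have l: "l > 0" using tn_nonneg[OF y] e \<eta> by (simp add: l_def add_nonneg_pos)
    obtain u where u: "u \<in> U 0" "y = l *\<^sub>R u" using tn_less[OF y, of l] e \<eta> by (auto simp: l_def)
    have uY: "u \<in> Y s" using u(1) U_mono[of 0 s] s U_subset_Y by auto
    have "tn s y \<le> l * tn s u" using tn_scale[OF uY, of l] u(2) l by simp
    also have "\<dots> \<le> l * (R * norm u + \<eta>)" using onU[OF u(1)] l by (intro mult_left_mono) auto
    also have "\<dots> = R * norm y + \<eta> * l" using u(2) l by (simp add: algebra_simps)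
    also have "\<dots> = R * norm y + \<eta> * tn 0 y + e" using \<eta> by (simp add: l_def algebra_simps)
    finally show "tn s y \<le> R * norm y + \<eta> * tn 0 y + e" .
  qed
  then show ?thesis using R0 by blast
qed

text \<open>Inserting \<open>tn_le_norm_plus\<close> into the bound on \<phi> gives the hypothesis
  of the sandwich theorem with error term \<open>\<delta> * tn 0 y\<close>. This error is at most
  \<delta> on \<open>U 0\<close>, and symmetry of \<open>U 0\<close> makes the estimate
  two-sided.\<close>

lemma approx_functional_on_U0:
  assumes s: "0 < s" "s < 1" and \<delta>: "\<delta> > 0"
    and add: "\<And>y z. y \<in> Y s \<Longrightarrow> z \<in> Y s \<Longrightarrow> \<phi> (y + z) = \<phi> y + \<phi> z"
    and scale: "\<And>a y. y \<in> Y s \<Longrightarrow> \<phi> (a *\<^sub>R y) = a * \<phi> y"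
    and bound: "\<And>y. y \<in> Y s \<Longrightarrow> \<phi> y \<le> \<beta> * tn s y"
  shows "\<exists>h :: 'x \<Rightarrow>\<^sub>L real. \<forall>y\<in>U 0. \<bar>\<phi> y - h y\<bar> \<le> \<delta>"
proof -
  define b where "b = \<bar>\<beta>\<bar> + 1"
  have b: "b > 0" "\<beta> \<le> b" by (auto simp: b_def)
  obtain R where R: "R \<ge> 0" "\<And>y. y \<in> Y 0 \<Longrightarrow> tn s y \<le> R * norm y + \<delta> / b * tn 0 y"
    using tn_le_norm_plus[OF s, of "\<delta> / b"] \<delta> b by auto
  have Y0: "y \<in> Y s" if "y \<in> Y 0" for y using that Y_mono[of 0 s] s by auto
  have "\<exists>h :: 'x \<Rightarrow>\<^sub>L real. \<forall>y\<in>Y 0. \<phi> y - \<delta> * tn 0 y \<le> h y"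
  proof (rule hahn_banach_sandwich[OF Y_subspace, where R = "b * R"])
    show "0 \<le> b * R" using b R by simp
    show "\<delta> * tn 0 (y + z) \<le> \<delta> * tn 0 y + \<delta> * tn 0 z" if "y \<in> Y 0" "z \<in> Y 0" for y z
      using tn_add[OF that] \<delta> by (simp flip: distrib_left)
    show "\<delta> * tn 0 (t *\<^sub>R y) \<le> t * (\<delta> * tn 0 y)" if "y \<in> Y 0" "t > 0" for t y
      using tn_scale[OF that(1), of t] \<delta> that(2) by (simp add: mult.left_commute)
    show "\<phi> y \<le> b * R * norm y + \<delta> * tn 0 y" if "y \<in> Y 0" for y
    proof -
      have "\<phi> y \<le> b * tn s y"
        using bound[OF Y0[OF that]] b(2) tn_nonneg[OF Y0[OF that]] by (meson mult_right_mono order_trans)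
      also have "\<dots> \<le> b * (R * norm y + \<delta> / b * tn 0 y)" using R(2)[OF that] b by (intro mult_left_mono) auto
      also have "\<dots> = b * R * norm y + \<delta> * tn 0 y" using b by (simp add: algebra_simps)
      finally show ?thesis .
    qed
  qed (use add scale Y0 in auto)
  then obtain h :: "'x \<Rightarrow>\<^sub>L real" where h: "\<And>y. y \<in> Y 0 \<Longrightarrow> \<phi> y - \<delta> * tn 0 y \<le> h y" by blast
  have le: "\<phi> y - h y \<le> \<delta>" if "y \<in> U 0" for y
  proof -
    have "\<delta> * tn 0 y \<le> \<delta> * 1" using tn_U[OF that] \<delta> by (intro mult_left_mono) auto
    then show ?thesis using h[of y] that U_subset_Y by fastforce
  qed
  have "\<bar>\<phi> y - h y\<bar> \<le> \<delta>" if y: "y \<in> U 0" for y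
  proof -
    have "\<phi> (- y) = - \<phi> y" using scale[of y "-1"] Y0 U_subset_Y y by auto
    then show ?thesis using le[OF y] le[OF U_minus[OF y]] by (simp add: blinfun.minus_right)
  qed
  then show ?thesis by blast
qed

text \<open>\<open>W\<close> is of finite rank but bounded only for \<open>tn s\<close>. Replacing
  its coordinate functionals by functionals on \<open>X\<close> that are close on
  \<open>U 0\<close>, and dividing by \<open>a\<close>, gives a bounded finite rank operator on
  \<open>X\<close> near the identity on \<open>U 0\<close>; \<open>K_bad\<close> limits how near it
  can be.\<close>

lemma finite_rank_approx_bound:
  assumes K_bad: "\<And>V :: 'x \<Rightarrow>\<^sub>L 'x. finite_rank V \<Longrightarrow> (SUP y\<in>U 0. norm (y - V y)) \<ge> c"
    and s: "0 < s" "s < 1" and a: "a \<noteq> 0" and \<epsilon>: "\<epsilon> \<ge> 0"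
    and add: "\<And>y z. y \<in> Y s \<Longrightarrow> z \<in> Y s \<Longrightarrow> W (y + z) = W y + W z"
    and scale: "\<And>t y. y \<in> Y s \<Longrightarrow> W (t *\<^sub>R y) = t *\<^sub>R W y"
    and bound: "\<And>y. y \<in> Y s \<Longrightarrow> norm (W y) \<le> \<beta> * tn s y"
    and B: "finite B" "\<And>y. y \<in> Y s \<Longrightarrow> W y \<in> span B"
    and approx: "\<And>y. y \<in> Y s \<Longrightarrow> norm (a *\<^sub>R y - W y) \<le> \<epsilon> * tn s y"
  shows "c * \<bar>a\<bar> \<le> \<epsilon>"
proof (rule ccontr)
  assume less: "\<not> c * \<bar>a\<bar> \<le> \<epsilon>"
  \<comment> \<open>Half of the gap, leaving \<open>\<epsilon> + \<eta>\<close> strictly below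
    \<open>c * \<bar>a\<bar>\<close>.\<close>
  define \<eta> where "\<eta> = (c * \<bar>a\<bar> - \<epsilon>) / 2"
  have \<eta>: "\<eta> > 0" "\<epsilon> + \<eta> < c * \<bar>a\<bar>" using less by (auto simp: \<eta>_def field_simps)
  obtain d :: nat and h :: "nat \<Rightarrow> 'x \<Rightarrow>\<^sub>L real" and e where P: "\<forall>y\<in>span B. y = (\<Sum>i<d. h i y *\<^sub>R e i)"
    using finite_span_retraction[OF B(1)] by blast
  \<comment> \<open>The \<open>d\<close> coordinate errors, each weighted by
    \<open>norm (e i)\<close>, then add up to at most \<eta>; both added ones keep the denominators
    positive.\<close>
  define \<delta> where "\<delta> = (\<lambda>i. \<eta> / (real d + 1) / (norm (e i) + 1))"
  have "\<exists>k :: 'x \<Rightarrow>\<^sub>L real. \<forall>y\<in>U 0. \<bar>h i (W y) - k y\<bar> \<le> \<delta> i" for i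
  proof (rule approx_functional_on_U0[OF s])
    show "\<delta> i > 0" using \<eta> by (simp add: \<delta>_def add_nonneg_pos)
    show "h i (W (y + z)) = h i (W y) + h i (W z)" if "y \<in> Y s" "z \<in> Y s" for y z
      using add[OF that] by (simp add: blinfun.add_right)
    show "h i (W (t *\<^sub>R y)) = t * h i (W y)" if "y \<in> Y s" for t y
      using scale[OF that] by (simp add: blinfun.scaleR_right)
    show "h i (W y) \<le> (norm (h i) * \<beta>) * tn s y" if "y \<in> Y s" for y
    proof -
      have "h i (W y) \<le> norm (h i) * norm (W y)" using norm_blinfun[of "h i" "W y"] by simp
      also have "\<dots> \<le> norm (h i) * (\<beta> * tn s y)" using bound[OF that] by (intro mult_left_mono) auto
      finally show ?thesis by (simp add: mult.assoc)
    qed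
  qed
  then obtain k :: "nat \<Rightarrow> 'x \<Rightarrow>\<^sub>L real" where k: "\<And>i y. y \<in> U 0 \<Longrightarrow> \<bar>h i (W y) - k i y\<bar> \<le> \<delta> i" by metis
  define V where "V = Blinfun (\<lambda>y. (1 / a) *\<^sub>R (\<Sum>i<d. k i y *\<^sub>R e i))"
  have "bounded_linear (\<lambda>y. (1 / a) *\<^sub>R (\<Sum>i<d. k i y *\<^sub>R e i))"
    by (intro bounded_linear_const_scaleR bounded_linear_sum bounded_linear_scaleR_const blinfun.bounded_linear_right)
  then have V: "V y = (1 / a) *\<^sub>R (\<Sum>i<d. k i y *\<^sub>R e i)" for y by (simp add: V_def bounded_linear_Blinfun_apply)
  have "finite_rank V" unfolding finite_rank_def
    by (intro exI[of _ "e ` {..<d}"]) (auto simp: V intro!: span_scale[OF span_sum] intro: span_scale span_base)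
  have "norm (y - V y) \<le> (\<epsilon> + \<eta>) / \<bar>a\<bar>" if y: "y \<in> U 0" for y
  proof -
    have ys: "y \<in> Y s" "tn s y \<le> 1" using y U_mono[of 0 s] s U_subset_Y tn_U by auto
    \<comment> \<open>\<open>W y\<close> lies in \<open>span B\<close>, so it is recovered from its
      coordinates and only the errors of the functionals remain.\<close>
    have "norm (W y - a *\<^sub>R V y) = norm (\<Sum>i<d. (h i (W y) - k i y) *\<^sub>R e i)"
      using P B(2)[OF ys(1)] a by (simp add: V scaleR_diff_left sum_subtractf)
    also have "\<dots> \<le> (\<Sum>i<d. \<eta> / (real d + 1))"
    proof (rule sum_norm_le)
      fix i
      have "norm ((h i (W y) - k i y) *\<^sub>R e i) \<le> \<delta> i * (norm (e i) + 1)"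
        unfolding norm_scaleR using k[OF y, of i] by (intro mult_mono) (auto intro: order_trans[OF abs_ge_zero])
      also have "\<dots> = \<eta> / (real d + 1)"
      proof -
        have "norm (e i) + 1 \<noteq> 0" by (smt (verit) norm_ge_zero)
        then show ?thesis by (simp add: \<delta>_def)
      qed
      finally show "norm ((h i (W y) - k i y) *\<^sub>R e i) \<le> \<eta> / (real d + 1)" .
    qed
    also have "\<dots> \<le> \<eta>" using \<eta>(1) by (simp add: field_simps)
    finally have "norm (W y - a *\<^sub>R V y) \<le> \<eta>" .
    moreover have "norm (a *\<^sub>R y - W y) \<le> \<epsilon>"
      using approx[OF ys(1)] mult_left_mono[OF ys(2) \<epsilon>] by simp
    moreover have "norm (a *\<^sub>R (y - V y)) \<le> norm (a *\<^sub>R y - W y) + norm (W y - a *\<^sub>R V y)"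
      using norm_triangle_ineq[of "a *\<^sub>R y - W y" "W y - a *\<^sub>R V y"] by (simp add: scaleR_diff_right)
    ultimately have "\<bar>a\<bar> * norm (y - V y) \<le> \<epsilon> + \<eta>" by simp
    then show ?thesis using a by (simp add: field_simps)
  qed
  then have "(SUP y\<in>U 0. norm (y - V y)) \<le> (\<epsilon> + \<eta>) / \<bar>a\<bar>"
    using U_0 by (intro cSUP_least) auto
  then have "c \<le> (\<epsilon> + \<eta>) / \<bar>a\<bar>" using K_bad[OF \<open>finite_rank V\<close>] by linarith
  then show False using \<eta>(2) a by (simp add: field_simps)
qed

end

section \<open>The embedding\<close>

text \<open>For \<open>r\<close> strictly between \<open>1/(n+3)\<close> and \<open>1/(n+2)\<close>
  the floor of \<open>1/r\<close> is \<open>n + 2\<close>, which explains the offset 2.\<close>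

definition spread :: "(nat \<Rightarrow> real) \<Rightarrow> real \<Rightarrow> real" where
  "spread a r = (if 0 < r \<and> r < 1/2 then a (nat \<lfloor>1 / r\<rfloor> - 2) else 0)"

lemma spread_measurable: "spread a \<in> borel_measurable borel"
proof -
  have fl: "(\<lambda>r::real. \<lfloor>1 / r\<rfloor>) \<in> measurable borel (count_space UNIV)" by measurable
  have "(\<lambda>k. a (nat k - 2)) \<in> measurable (count_space UNIV) borel" by simp
  from measurable_compose[OF fl this]
  have "(\<lambda>r::real. a (nat \<lfloor>1 / r\<rfloor> - 2)) \<in> borel_measurable borel" .
  then show ?thesis unfolding spread_def by measurable
qed

lemma spread_add: "spread (\<lambda>n. a n + b n) r = spread a r + spread b r"
  and spread_scale: "spread (\<lambda>n. t * a n) r = t * spread a r"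
  by (auto simp: spread_def)

lemma spread_support: "spread a r \<noteq> 0 \<Longrightarrow> r \<le> 1/2"
  by (auto simp: spread_def split: if_splits)

lemma spread_eq: assumes "1 / (real n + 3) < r" "r < 1 / (real n + 2)" shows "spread a r = a n"
proof -
  have r: "r > 0" using assms(1) by (smt (verit) divide_nonneg_nonneg of_nat_0_le_iff)
  have "1 / r < real n + 3" "real n + 2 < 1 / r" using assms r by (auto simp: field_simps)
  then have "\<lfloor>1 / r\<rfloor> = int n + 2" by linarith
  moreover have "r < 1/2" using assms(2) by (rule order_less_le_trans) (simp add: field_simps)
  ultimately show ?thesis using r by (simp add: spread_def nat_add_distrib)
qed

section \<open>Estimates for the supremum norm and the quotient norm\<close>

lemma abs_le_c0_norm: assumes "a \<in> c0" shows "\<bar>a n\<bar> \<le> c0_norm a"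
proof -
  have "Bseq a" using assms by (auto simp: c0_def intro: convergent_imp_Bseq convergentI)
  then have "bdd_above (range (\<lambda>n. \<bar>a n\<bar>))" by (auto simp: Bseq_def intro: bdd_aboveI2)
  then show ?thesis unfolding c0_norm_def by (intro cSUP_upper) auto
qed

lemma abs_spread_le: assumes "a \<in> c0" shows "\<bar>spread a r\<bar> \<le> c0_norm a"
  using abs_le_c0_norm[OF assms] order_trans[OF abs_ge_zero abs_le_c0_norm[OF assms, of 0]]
  by (auto simp: spread_def)

lemma zero_approximable: "0 \<in> approximable_ops"
proof -
  have "finite_rank (0 :: 'a::real_normed_vector \<Rightarrow>\<^sub>L 'b::real_normed_vector)"
    unfolding finite_rank_def by (intro exI[of _ "{}"]) auto
  then show ?thesis unfolding approximable_ops_def by (intro closure_subset[THEN subsetD]) auto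
qed

lemma quot_norm_le: "quot_norm T \<le> norm T"
  unfolding quot_norm_def using infdist_le[OF zero_approximable, of T] by simp

text \<open>The inequality is a closed condition on \<open>F\<close>, so it passes from finite rank
  operators to their closure.\<close>

lemma quot_norm_ge:
  assumes "\<And>F. finite_rank F \<Longrightarrow> k \<le> norm (T - F)"
  shows "k \<le> quot_norm T"
proof -
  have "closed {F. k \<le> norm (T - F)}" by (intro closed_Collect_le continuous_intros)
  then have "approximable_ops \<subseteq> {F. k \<le> norm (T - F)}"
    unfolding approximable_ops_def using assms by (intro closure_minimal) auto
  then show ?thesis unfolding quot_norm_def infdist_def
    using zero_approximable by (auto simp: dist_norm intro!: cINF_greatest)
qed

context willis_space
begin

section \<open>Weighted integrals of step functions\<close>

definition avg :: "(real \<Rightarrow> real) \<Rightarrow> (real \<Rightarrow> 'x) \<Rightarrow> 'x" where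
  "avg g f = integral {0..1} (\<lambda>r. g r *\<^sub>R f r)"

lemma avg_linear:
  assumes g: "g \<in> borel_measurable borel" "\<And>r. \<bar>g r\<bar> \<le> M" and f: "f \<in> steps"
  shows avg_add: "f' \<in> steps \<Longrightarrow> avg g (\<lambda>r. f r + f' r) = avg g f + avg g f'"
    and avg_scale: "avg g (\<lambda>r. a *\<^sub>R f r) = a *\<^sub>R avg g f"
proof -
  show "avg g (\<lambda>r. f r + f' r) = avg g f + avg g f'" if "f' \<in> steps"
    unfolding avg_def using integral_add[OF steps_integral(2)[OF f g] steps_integral(2)[OF that g]]
    by (simp add: scaleR_add_right)
  show "avg g (\<lambda>r. a *\<^sub>R f r) = a *\<^sub>R avg g f"
    unfolding avg_def by (subst integral_cmul[symmetric]) (simp add: mult.commute)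
qed

lemma avg_Y:
  assumes g: "g \<in> borel_measurable borel" "\<And>r. \<bar>g r\<bar> \<le> M" and f: "f \<in> steps"
    and t: "\<And>r. g r \<noteq> 0 \<Longrightarrow> r \<le> t"
  shows "avg g f \<in> Y t" "tn t (avg g f) \<le> M * norm (j f)"
  unfolding avg_def using steps_integral(3)[OF f g t] j_isometry[OF f] by auto

lemma avg_bump:
  assumes "0 < p" "p < q" "q < 1" "\<And>r. r \<in> {p<..<q} \<Longrightarrow> g r = k"
  shows "avg g (bump p q y) = ((q - p) * k) *\<^sub>R y"
proof -
  have "(\<lambda>r. g r *\<^sub>R bump p q y r) = (\<lambda>r. indicator {p<..<q} r *\<^sub>R (k *\<^sub>R y))"
    using assms(4) by (auto simp: bump_def indicator_def)
  then show ?thesis unfolding avg_def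
    using integral_unique[OF has_integral_indicator_Ioo[of 0 p q 1 "k *\<^sub>R y"]] assms by simp
qed

text \<open>Every fibre gauge with parameter at most 1 dominates the norm of \<open>X\<close>, so
  integration over a subinterval is a contraction into \<open>X\<close>. It is a plain integral, not
  divided by the length of the interval.\<close>

lemma exists_average_op:
  assumes pq: "0 < p" "p < q" "q < 1"
  shows "\<exists>C :: 'z \<Rightarrow>\<^sub>L 'x. norm C \<le> 1 \<and> (\<forall>f\<in>steps. blinfun_apply C (j f) = avg (indicator {p<..<q}) f)"
proof -
  let ?g = "indicator {p<..<q} :: real \<Rightarrow> real"
  have g: "?g \<in> borel_measurable borel" "\<bar>?g r\<bar> \<le> 1" "?g r \<noteq> 0 \<Longrightarrow> r \<le> 1" for r
    using pq by (auto simp: indicator_def split: if_splits)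
  have bound: "norm (avg ?g f) \<le> 1 * norm (j f)" if "f \<in> steps" for f
    using norm_le_tn[OF avg_Y(1)[OF g(1,2) that, of 1]] avg_Y(2)[OF g(1,2) that, of 1] g(3) by force
  have "\<exists>C :: 'z \<Rightarrow>\<^sub>L 'x. \<forall>f\<in>steps. C (j f) = avg ?g f"
    by (rule extend_from_steps[OF avg_add[OF g(1,2)] avg_scale[OF g(1,2)] bound])
  then obtain C :: "'z \<Rightarrow>\<^sub>L 'x" where C: "\<forall>f\<in>steps. C (j f) = avg ?g f" by blast
  have "norm C \<le> 1" by (rule norm_blinfun_le_on_steps) (use C bound in auto)
  then show ?thesis using C by blast
qed

text \<open>Averaging against \<open>spread a\<close> only sees fibres up to parameter \<open>1/2\<close>, while the
  image lives on fibres from \<open>3/5\<close> on; the inclusion between them is compact.\<close>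

definition G :: "(nat \<Rightarrow> real) \<Rightarrow> (real \<Rightarrow> 'x) \<Rightarrow> 'z" where
  "G a f = 5 *\<^sub>R E (3/5) (4/5) (avg (spread a) f)"

text \<open>The factor 5 cancels the length 1/5 of the interval from 3/5 to 4/5.\<close>

lemma E_Y_half:
  assumes "y \<in> Y (1/2)"
  shows "y \<in> Y (3/5)" "norm (5 *\<^sub>R E (3/5) (4/5) y) \<le> tn (1/2) y"
proof -
  show y: "y \<in> Y (3/5)" using assms Y_mono[of "1/2" "3/5"] by auto
  show "norm (5 *\<^sub>R E (3/5) (4/5) y) \<le> tn (1/2) y"
    using E_norm_le[of "3/5" "4/5" y] y tn_antimono[OF assms, of "3/5"] by simp
qed

text \<open>For \<open>a \<in> c0\<close> such an operator exists by \<open>psi_steps\<close>, and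
  density of the step functions makes it unique.\<close>

definition psi :: "(nat \<Rightarrow> real) \<Rightarrow> 'z \<Rightarrow>\<^sub>L 'z" where
  "psi a = (SOME T. \<forall>f\<in>steps. blinfun_apply T (j f) = G a f)"

context
  fixes a :: "nat \<Rightarrow> real"
  assumes a: "a \<in> c0"
begin

lemmas spread_a = spread_measurable[of a] abs_spread_le[OF a]

lemma avg_spread:
  assumes "f \<in> steps"
  shows "avg (spread a) f \<in> Y (1/2)" "tn (1/2) (avg (spread a) f) \<le> c0_norm a * norm (j f)"
  using avg_Y[OF spread_a assms spread_support] by auto

lemma G_bound: "f \<in> steps \<Longrightarrow> norm (G a f) \<le> c0_norm a * norm (j f)"
  unfolding G_def using E_Y_half(2)[OF avg_spread(1)] avg_spread(2) by (meson order_trans)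

lemma psi_steps: assumes "f \<in> steps" shows "psi a (j f) = G a f"
proof -
  have "\<exists>T :: 'z \<Rightarrow>\<^sub>L 'z. \<forall>f\<in>steps. T (j f) = G a f"
  proof (rule extend_from_steps)
    show "G a (\<lambda>r. f r + g r) = G a f + G a g" if "f \<in> steps" "g \<in> steps" for f g
      unfolding G_def avg_add[OF spread_a that]
      using that by (simp add: E_add E_Y_half(1) avg_spread(1) scaleR_add_right)
    show "G a (\<lambda>r. t *\<^sub>R f r) = t *\<^sub>R G a f" if "f \<in> steps" for t f
      unfolding G_def avg_scale[OF spread_a that]
      using that by (simp add: E_scale E_Y_half(1) avg_spread(1))
  qed (rule G_bound)
  then show ?thesis unfolding psi_def using assms someI_ex[of "\<lambda>T :: 'z \<Rightarrow>\<^sub>L 'z. \<forall>f\<in>steps. T (j f) = G a f"] by blast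
qed

lemma norm_psi_le: "norm (psi a) \<le> c0_norm a"
  by (rule norm_blinfun_le_on_steps)
     (use G_bound psi_steps order_trans[OF abs_ge_zero abs_le_c0_norm[OF a]] in auto)

text \<open>The weighted integral sends step functions of norm below 1 into a multiple of
  \<open>U (1/2)\<close>, whose image under \<open>E (3/5) (4/5)\<close> is relatively compact
  because 1/2 < 3/5.\<close>

lemma psi_compact: "compact_op (psi a)"
proof -
  \<comment> \<open>The added 1 gives the strict inequality that \<open>tn_less\<close> requires,
    also for the zero sequence.\<close>
  define M where "M = c0_norm a + 1"
  have M: "M > 0" using order_trans[OF abs_ge_zero abs_le_c0_norm[OF a, of 0]] by (simp add: M_def)
  define C where "C = (\<lambda>z. (5 * M) *\<^sub>R z) ` closure (E (3/5) (4/5) ` U (1/2))"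
  have "compact (closure (E (3/5) (4/5) ` U (1/2)))"
    by (rule compact_closure_image_U[where t = "3/5" and \<beta> = "4/5 - 3/5"])
       ((simp; fail) | (rule E_add E_scale E_norm_le; simp; fail))+
  then have C: "compact C" unfolding C_def by (rule compact_scaling)
  have "psi a (j f) \<in> C" if fs: "f \<in> steps" "norm (j f) < 1" for f
  proof -
    have "c0_norm a * norm (j f) \<le> c0_norm a * 1"
      using fs(2) order_trans[OF abs_ge_zero abs_le_c0_norm[OF a]] by (intro mult_left_mono) auto
    then have "tn (1/2) (avg (spread a) f) < M" using avg_spread(2)[OF fs(1)] by (simp add: M_def)
    then obtain u where u: "u \<in> U (1/2)" "avg (spread a) f = M *\<^sub>R u"
      using tn_less[OF avg_spread(1)[OF fs(1)]] by blast
    have "u \<in> Y (1/2)" using u(1) U_subset_Y by blast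
    then have "psi a (j f) = (5 * M) *\<^sub>R E (3/5) (4/5) u"
      unfolding psi_steps[OF fs(1)] G_def u(2) using E_Y_half(1) by (simp add: E_scale)
    then show ?thesis unfolding C_def
      by (metis imageI subsetD[OF closure_subset] u(1))
  qed
  then have "ball 0 1 \<inter> j ` steps \<subseteq> psi a -` C" by auto
  moreover have "closed (psi a -` C)"
    using C by (intro closed_vimage compact_imp_closed continuous_intros)
  ultimately have "closure (ball 0 1 \<inter> j ` steps) \<subseteq> psi a -` C" by (rule closure_minimal)
  \<comment> \<open>The unit ball is open, so a dense set is dense in it; the closed set
    \<open>C\<close> therefore receives the image of the whole ball.\<close>
  moreover have "ball 0 1 \<inter> closure (j ` steps) \<subseteq> closure (ball 0 1 \<inter> j ` steps)"
    by (rule open_Int_closure_subset) simp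
  ultimately have "psi a ` ball 0 1 \<subseteq> C" using j_dense by auto
  then have "closure (psi a ` ball 0 1) \<subseteq> C" using C by (intro closure_minimal compact_imp_closed)
  then show ?thesis unfolding compact_op_def
    using C compact_Int_closed[of C "closure (psi a ` ball 0 1)"] by (simp add: Int_absorb1)
qed

lemma quot_norm_psi_ge:
  assumes K_bad: "\<And>V :: 'x \<Rightarrow>\<^sub>L 'x. finite_rank V \<Longrightarrow> (SUP y\<in>U 0. norm (y - V y)) \<ge> c"
  shows "c * \<bar>a n\<bar> \<le> quot_norm (psi a)"
\<comment> \<open>The vanishing coordinate is separated because the other case divides by
  \<open>a n\<close>.\<close>
proof (cases "a n = 0")
  case True
  then show ?thesis by (simp add: quot_norm_def infdist_nonneg)
next
  case False
  show ?thesis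
  proof (rule quot_norm_ge)
    fix F :: "'z \<Rightarrow>\<^sub>L 'z" assume "finite_rank F"
    then obtain B where B: "finite B" "\<And>z. F z \<in> span B" unfolding finite_rank_def by blast
    obtain C :: "'z \<Rightarrow>\<^sub>L 'x" where C: "norm C \<le> 1" "\<And>f. f \<in> steps \<Longrightarrow> blinfun_apply C (j f) = avg (indicator {3/5<..<4/5}) f"
      using exists_average_op[of "3/5" "4/5"] by auto
    \<comment> \<open>The endpoints of the interval on which \<open>spread a\<close> is constantly
      \<open>a n\<close>.\<close>
    define s q where "s = 1 / (real n + 3)" and "q = 1 / (real n + 2)"
    have sq: "0 < s" "s < q" "q < 1" by (auto simp: s_def q_def field_simps)
    have q: "q \<le> 1/2" by (simp add: q_def field_simps)
    define W where "W = (\<lambda>y. C (F ((1 / (q - s)) *\<^sub>R E s q y)))"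
    have Bnorm: "norm ((1 / (q - s)) *\<^sub>R E s q y) \<le> tn s y" if "y \<in> Y s" for y
      using E_norm_le[OF sq that] sq by (simp add: field_simps)
    have Cle: "norm (C z) \<le> norm z" for z
      using norm_blinfun[of C z] mult_right_mono[OF C(1), of "norm z"] by simp
    \<comment> \<open>The length \<open>q - s\<close> cancels against the normalisation of the bump,
      and the factor 5 in \<open>G\<close> against the factor 1/5 from integrating over the target
      interval.\<close>
    have psiE: "C (psi a ((1 / (q - s)) *\<^sub>R E s q y)) = a n *\<^sub>R y" if y: "y \<in> Y s" for y
    proof -
      have y35: "y \<in> Y (3/5)" using y Y_mono[of s "3/5"] sq q by auto
      have "avg (spread a) (bump s q y) = ((q - s) * a n) *\<^sub>R y"
        by (rule avg_bump[OF sq]) (auto simp: spread_eq s_def q_def)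
      then have "psi a (E s q y) = (5 * ((q - s) * a n)) *\<^sub>R E (3/5) (4/5) y"
        unfolding E_def[of s q] using psi_steps[OF bump_in_steps[OF sq y]] y35 by (simp add: G_def E_scale)
      moreover have "C (E (3/5) (4/5) y) = (1/5) *\<^sub>R y"
        unfolding E_def using C(2)[OF bump_in_steps] y35
          avg_bump[of "3/5" "4/5" "indicator {3/5<..<4/5}" 1 y] by simp
      ultimately show ?thesis using sq by (simp add: blinfun.scaleR_right)
    qed
    show "c * \<bar>a n\<bar> \<le> norm (psi a - F)"
    proof (rule finite_rank_approx_bound[OF K_bad, where s = s and W = W and \<beta> = "norm F" and B = "C ` B"])
      show "s < 1" using sq by simp
      show "W (y + z) = W y + W z" if "y \<in> Y s" "z \<in> Y s" for y z
        unfolding W_def using E_add[OF sq that] by (simp add: blinfun.bilinear_simps scaleR_add_right)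
      show "W (t *\<^sub>R y) = t *\<^sub>R W y" if "y \<in> Y s" for t y
        unfolding W_def using E_scale[OF sq that] by (simp add: blinfun.bilinear_simps)
      show "norm (W y) \<le> norm F * tn s y" if "y \<in> Y s" for y
      proof -
        have "norm (W y) \<le> norm F * norm ((1 / (q - s)) *\<^sub>R E s q y)"
          unfolding W_def using Cle norm_blinfun by (rule order_trans)
        also have "\<dots> \<le> norm F * tn s y" using Bnorm[OF that] by (intro mult_left_mono) auto
        finally show ?thesis .
      qed
      show "W y \<in> span (C ` B)" for y
      proof -
        have "linear C" by (simp add: bounded_linear.linear blinfun.bounded_linear_right)
        then show ?thesis unfolding W_def using B(2) linear_span_image by blast
      qed
      show "norm (a n *\<^sub>R y - W y) \<le> norm (psi a - F) * tn s y" if "y \<in> Y s" for y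
      proof -
        have "a n *\<^sub>R y - W y = C ((psi a - F) ((1 / (q - s)) *\<^sub>R E s q y))"
          unfolding W_def psiE[OF that, symmetric] by (simp add: blinfun.diff_left blinfun.diff_right)
        then have "norm (a n *\<^sub>R y - W y) \<le> norm (psi a - F) * norm ((1 / (q - s)) *\<^sub>R E s q y)"
          using Cle norm_blinfun order_trans by metis
        also have "\<dots> \<le> norm (psi a - F) * tn s y" using Bnorm[OF that] by (intro mult_left_mono) auto
        finally show ?thesis .
      qed
    qed (use False sq B in auto)
  qed
qed

end

section \<open>Linear dependence of the operator on the sequence\<close>

lemma avg_spread_add:
  assumes "a \<in> c0" "b \<in> c0" "f \<in> steps"
  shows "avg (spread (\<lambda>n. a n + b n)) f = avg (spread a) f + avg (spread b) f"
  unfolding avg_def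
  using integral_add[OF steps_integral(2)[OF assms(3) spread_a[OF assms(1)]] steps_integral(2)[OF assms(3) spread_a[OF assms(2)]]]
  by (simp add: spread_add scaleR_add_left)

lemma avg_spread_scale: "avg (spread (\<lambda>n. t * a n)) f = t *\<^sub>R avg (spread a) f"
  unfolding avg_def by (subst integral_cmul[symmetric]) (simp add: spread_scale)

lemma psi_add: assumes "a \<in> c0" "b \<in> c0" shows "psi (\<lambda>n. a n + b n) = psi a + psi b"
proof (rule blinfun_eq_on_steps)
  fix f assume f: "f \<in> steps"
  have ab: "(\<lambda>n. a n + b n) \<in> c0" using assms tendsto_add[of a 0 sequentially b 0] by (simp add: c0_def)
  show "psi (\<lambda>n. a n + b n) (j f) = (psi a + psi b) (j f)"
    unfolding blinfun.add_left psi_steps[OF ab f] psi_steps[OF assms(1) f] psi_steps[OF assms(2) f] G_def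
      avg_spread_add[OF assms f]
    using avg_spread(1)[OF assms(1) f] avg_spread(1)[OF assms(2) f]
    by (simp add: E_add E_Y_half(1) scaleR_add_right)
qed

lemma psi_scale: assumes "a \<in> c0" shows "psi (\<lambda>n. t * a n) = t *\<^sub>R psi a"
proof (rule blinfun_eq_on_steps)
  fix f assume f: "f \<in> steps"
  have ta: "(\<lambda>n. t * a n) \<in> c0" using assms tendsto_mult_right_zero[of a sequentially t] by (simp add: c0_def)
  show "psi (\<lambda>n. t * a n) (j f) = (t *\<^sub>R psi a) (j f)"
    unfolding blinfun.scaleR_left psi_steps[OF ta f] psi_steps[OF assms(1) f] G_def avg_spread_scale
    using avg_spread(1)[OF assms(1) f] by (simp add: E_scale E_Y_half(1))
qed

end

text \<open>The map into the quotient is described by representatives: linearity is required modulo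
  approximable operators and the bounds concern the quotient norm, whose lower bound makes the range
  closed. The witness \<open>psi\<close> is exactly linear on \<open>c0\<close>, and the constants
  are \<open>c\<close> and 1.\<close>

theorem theorem3p3:
  fixes x :: "nat \<Rightarrow> 'x::banach"
    and c :: real
    and j :: "(real \<Rightarrow> 'x) \<Rightarrow> 'z::banach"
  assumes noAP: "\<not> has_AP TYPE('x)"
    and x_pos: "\<And>n. 0 < norm (x n) \<and> norm (x n) \<le> 1"
    and x_lim: "(\<lambda>n. norm (x n)) \<longlonglongrightarrow> 0"
    and c_pos: "c > 0"
    and K_bad: "\<And>V::'x \<Rightarrow>\<^sub>L 'x. finite_rank V \<Longrightarrow>
        (SUP y\<in>closure (convex hull (\<Union>n. {x n, - x n})). norm (y - V y)) \<ge> c"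
    and j_add: "\<And>f g. f \<in> willis_steps x \<Longrightarrow> g \<in> willis_steps x \<Longrightarrow>
        j (\<lambda>r. f r + g r) = j f + j g"
    and j_scale: "\<And>a f. f \<in> willis_steps x \<Longrightarrow> j (\<lambda>r. a *\<^sub>R f r) = a *\<^sub>R j f"
    and j_isometry: "\<And>f. f \<in> willis_steps x \<Longrightarrow> norm (j f) = willis_norm x f"
    and j_dense: "closure (j ` willis_steps x) = UNIV"
  shows "\<exists>\<psi> :: (nat \<Rightarrow> real) \<Rightarrow> ('z \<Rightarrow>\<^sub>L 'z).
           (\<forall>a\<in>c0. compact_op (\<psi> a)) \<and>
           (\<forall>a\<in>c0. \<forall>b\<in>c0. \<psi> (\<lambda>n. a n + b n) - (\<psi> a + \<psi> b) \<in> approximable_ops) \<and>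
           (\<forall>t. \<forall>a\<in>c0. \<psi> (\<lambda>n. t * a n) - t *\<^sub>R \<psi> a \<in> approximable_ops) \<and>
           (\<exists>m M. 0 < m \<and> 0 < M \<and>
              (\<forall>a\<in>c0. m * c0_norm a \<le> quot_norm (\<psi> a) \<and> quot_norm (\<psi> a) \<le> M * c0_norm a))"
proof -
  interpret willis_space x j
    by unfold_locales (use x_pos x_lim j_add j_scale j_isometry j_dense in auto)
  \<comment> \<open>At exponent 0 the scaling factor is 1, the norms being nonzero; so the bad
    compact set is the ball at parameter 0.\<close>
  have U0: "closure (convex hull (\<Union>n. {x n, - x n})) = willis_U x 0"
    using x_pos by (simp add: willis_U_def less_imp_neq[symmetric])
  have lower: "c * c0_norm a \<le> quot_norm (psi a)" if a: "a \<in> c0" for a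
  proof -
    have "\<bar>a n\<bar> \<le> quot_norm (psi a) / c" for n
      using quot_norm_psi_ge[OF a K_bad[unfolded U0], of n] c_pos by (simp add: field_simps)
    then have "c0_norm a \<le> quot_norm (psi a) / c" unfolding c0_norm_def by (intro cSUP_least) auto
    then show ?thesis using c_pos by (simp add: field_simps)
  qed
  have upper: "quot_norm (psi a) \<le> 1 * c0_norm a" if "a \<in> c0" for a
    using quot_norm_le[of "psi a"] norm_psi_le[OF that] by simp
  show ?thesis
  proof (intro exI[of _ psi] conjI)
    show "\<exists>m M. 0 < m \<and> 0 < M \<and>
        (\<forall>a\<in>c0. m * c0_norm a \<le> quot_norm (psi a) \<and> quot_norm (psi a) \<le> M * c0_norm a)"
      using lower upper c_pos by (intro exI[of _ c] exI[of _ 1]) auto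
  qed (auto simp: psi_compact psi_add psi_scale zero_approximable)
qed

end
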